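(* There is a universal constant $C>0$ such that the following holds. Let $(x_0,y_0)\in\operatorname{dom}h_1\times\operatorname{dom}h_2$ and $\bar\varepsilon>0$, let $\lambda_1=D/(4M)$ and $\lambda_k=\lambda_1/\sqrt k$ for $k\ge1$, and run the modified PB-SPP$(x_0,y_0,\bar\varepsilon)$ described in the context. Then the total number of PDCP iterations (summed over all calls) performed until $(\bar x_k,\bar y_k)$ is an $\bar\varepsilon$-saddle-point is at most $C\left((MD/\bar\varepsilon)^{2}+1\right)$.
   Context: Saddle-point problem. $f(x,y)$, $(x,y)\in\mathbb R^n\times\mathbb R^m$, is convex in $x$ and concave in $y$; $h_1:\mathbb R^n\to\mathbb R\cup\{+\infty\}$ and $h_2:\mathbb R^m\to\mathbb R\cup\{+\infty\}$ are proper lower semicontinuous convex with $\operatorname{dom}h_1\times\operatorname{dom}h_2\subset\operatorname{dom}f$. The problem is $\min_x\max_y\{\phi(x,y)=f(x,y)+h_1(x)-h_2(y)\}$. Assumptions: there are maps $f_x',f_y'$ on $\operatorname{dom}h_1\times\operatorname{dom}h_2$ with $f_x'(u,v)$ a subgradient of $f(\cdot,v)$ at $u$ and $f_y'(u,v)$ a supergradient of $f(u,\cdot)$ at $v$; $\|f_x'(u,v)\|\le M$ and $\|f_y'(u,v)\|\le M$ for all $(u,v)\in\operatorname{dom}h_1\times\operatorname{dom}h_2$, for some $M>0$; $\operatorname{dom}h_1\times\operatorname{dom}h_2$ is bounded with diameter $D>0$; the set of saddle points is nonempty. A pair $(x,y)\in\operatorname{dom}h_1\times\operatorname{dom}h_2$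 is an $\bar\varepsilon$-saddle-point if $0\in\partial_{\bar\varepsilon}[\phi(\cdot,y)-\phi(x,\cdot)](x,y)$, i.e. $\phi(x,v)-\phi(u,y)\le\bar\varepsilon$ for all $(u,v)\in\operatorname{dom}h_1\times\operatorname{dom}h_2$. Modified PDCP (primal-dual cutting-plane) for a pair $(g,h)$, where $h$ is proper lower semicontinuous convex, $g$ is convex with a subgradient oracle $g'$ on $\operatorname{dom}h$, and $\ell_g(u;w)=g(w)+\langle g'(w),u-w\rangle$: PDCP$(w_0,\lambda,\varepsilon)$ with $w_0\in\operatorname{dom}h$ uses $h^\lambda(u)=h(u)+\frac1{2\lambda}\|u-w_0\|^2$, $\Gamma_1=\ell_g(\cdot;w_0)$. For $j=1,2,\dots$: $w_j=\operatorname{argmin}_u\{\Gamma_j(u)+h^\lambda(u)\}$ with minimum value $m_j$; $\Gamma_{j+1}$ is any $M$-Lipschitz continuous convex function with $\Gamma_{j+1}\le g$ and $\Gamma_{j+1}\ge\max\{\bar\Gamma_j,\ell_g(\cdot;w_j)\}$ for some proper lower semicontinuous convex $\bar\Gamma_j\le g$ with $\bar\Gamma_j(w_j)=\Gamma_j(w_j)$ and $w_j=\operatorname{argmin}_u\{\bar\Gamma_j(u)+h^\lambda(u)\}$. For $j\ge2$ let $A_j=j(j+1)/2$, $\hat w_2=w_2$, $\hat w_j=(3w_2+\sum_{i=3}^jiw_i)/A_j$ for $j\ge3$, and $\hat t_j=(g+h^\lambda)(\hat w_j)-m_j$. It stops at the first $j\ge2$ with $\hat t_j\le\varepsilon$ and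 returns $(w_j,\hat w_j)$. Modified PB-SPP$(x_0,y_0,\bar\varepsilon)$: for $k=1,2,\dots$, with stepsize $\lambda_k>0$, $(x_k,\hat x_k)=\text{PDCP}(x_{k-1},\lambda_k,\bar\varepsilon/4)$ applied to $g=f(\cdot,y_{k-1})$, $g'=f_x'(\cdot,y_{k-1})$, $h=h_1$; $(y_k,\hat y_k)=\text{PDCP}(y_{k-1},\lambda_k,\bar\varepsilon/4)$ applied to $g=-f(x_{k-1},\cdot)$, $g'=-f_y'(x_{k-1},\cdot)$, $h=h_2$; and $\bar x_k=\frac1k\sum_{i=1}^k\hat x_i$, $\bar y_k=\frac1k\sum_{i=1}^k\hat y_i$. *)

theory Defs
  imports "HOL-Analysis.Analysis"
begin

text \<open>
  The constant in the theorem must not depend on the dimensions, so these have to be ordinary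
  natural numbers that can be quantified below the constant, not types. Hence \<open>\<real>\<^sup>n\<close> is the
  carrier of \<^const>\<open>Euclidean_space\<close>: functions on \<open>nat\<close> vanishing from index \<open>n\<close> on, with
  coordinatewise operations. All functions below are only ever looked at on these carriers.
\<close>

type_synonym rvec = "nat \<Rightarrow> real"

abbreviation Rn :: "nat \<Rightarrow> rvec set" where
  "Rn n \<equiv> topspace (Euclidean_space n)"

definition dotp :: "nat \<Rightarrow> rvec \<Rightarrow> rvec \<Rightarrow> real" where
  "dotp n x y = (\<Sum>i<n. x i * y i)"

definition enorm :: "nat \<Rightarrow> rvec \<Rightarrow> real" where
  "enorm n x = L2_set x {..<n}"

definition vdiff :: "rvec \<Rightarrow> rvec \<Rightarrow> rvec" where
  "vdiff x y = (\<lambda>i. x i - y i)"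


section \<open>Extended-real-valued convex functions\<close>

definition edom :: "nat \<Rightarrow> (rvec \<Rightarrow> ereal) \<Rightarrow> rvec set" where
  "edom n h = {x \<in> Rn n. h x < \<infinity>}"

definition proper_fun :: "nat \<Rightarrow> (rvec \<Rightarrow> ereal) \<Rightarrow> bool" where
  "proper_fun n h \<longleftrightarrow> edom n h \<noteq> {} \<and> (\<forall>x\<in>Rn n. h x \<noteq> -\<infinity>)"

definition lsc_fun :: "nat \<Rightarrow> (rvec \<Rightarrow> ereal) \<Rightarrow> bool" where
  "lsc_fun n h \<longleftrightarrow> (\<forall>c::real. closedin (Euclidean_space n) {x \<in> Rn n. h x \<le> ereal c})"

text \<open>
  In \<open>ereal\<close>, \<open>\<infinity> + (-\<infinity>) = \<infinity>\<close>; therefore the following is convexity of the epigraph also for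
  functions that take both infinite values.
\<close>

definition convex_fun :: "nat \<Rightarrow> (rvec \<Rightarrow> ereal) \<Rightarrow> bool" where
  "convex_fun n h \<longleftrightarrow>
     (\<forall>x\<in>Rn n. \<forall>y\<in>Rn n. \<forall>t::real. 0 < t \<and> t < 1 \<longrightarrow>
        h (\<lambda>i. (1 - t) * x i + t * y i) \<le> ereal (1 - t) * h x + ereal t * h y)"

definition concave_fun :: "nat \<Rightarrow> (rvec \<Rightarrow> ereal) \<Rightarrow> bool" where
  "concave_fun n h \<longleftrightarrow> convex_fun n (\<lambda>x. - h x)"

definition proper_lsc_convex :: "nat \<Rightarrow> (rvec \<Rightarrow> ereal) \<Rightarrow> bool" where
  "proper_lsc_convex n h \<longleftrightarrow> proper_fun n h \<and> lsc_fun n h \<and> convex_fun n h"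

definition subgradient :: "nat \<Rightarrow> (rvec \<Rightarrow> ereal) \<Rightarrow> rvec \<Rightarrow> rvec \<Rightarrow> bool" where
  "subgradient n g u s \<longleftrightarrow>
     s \<in> Rn n \<and> (\<forall>u'\<in>Rn n. g u + ereal (dotp n s (vdiff u' u)) \<le> g u')"

definition supergradient :: "nat \<Rightarrow> (rvec \<Rightarrow> ereal) \<Rightarrow> rvec \<Rightarrow> rvec \<Rightarrow> bool" where
  "supergradient n g u s \<longleftrightarrow>
     s \<in> Rn n \<and> (\<forall>u'\<in>Rn n. g u' \<le> g u + ereal (dotp n s (vdiff u' u)))"

definition lipschitz_fun :: "nat \<Rightarrow> real \<Rightarrow> (rvec \<Rightarrow> real) \<Rightarrow> bool" where
  "lipschitz_fun n M G \<longleftrightarrow> (\<forall>u\<in>Rn n. \<forall>v\<in>Rn n. \<bar>G u - G v\<bar> \<le> M * enorm n (vdiff u v))"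

definition argmin_on :: "nat \<Rightarrow> (rvec \<Rightarrow> ereal) \<Rightarrow> rvec \<Rightarrow> bool" where
  "argmin_on n F w \<longleftrightarrow> is_arg_min F (\<lambda>u. u \<in> Rn n) w"


section \<open>The saddle-point problem\<close>

record spp =
  dimx :: nat
  dimy :: nat
  coupling :: "rvec \<Rightarrow> rvec \<Rightarrow> ereal"
  gradx :: "rvec \<Rightarrow> rvec \<Rightarrow> rvec"
  grady :: "rvec \<Rightarrow> rvec \<Rightarrow> rvec"
  regx :: "rvec \<Rightarrow> ereal"
  regy :: "rvec \<Rightarrow> ereal"

abbreviation domx :: "spp \<Rightarrow> rvec set" where
  "domx P \<equiv> edom (dimx P) (regx P)"

abbreviation domy :: "spp \<Rightarrow> rvec set" where
  "domy P \<equiv> edom (dimy P) (regy P)"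

definition dom_coupling :: "spp \<Rightarrow> (rvec \<times> rvec) set" where
  "dom_coupling P = {(u, v). u \<in> Rn (dimx P) \<and> v \<in> Rn (dimy P) \<and> \<bar>coupling P u v\<bar> \<noteq> \<infinity>}"

definition phi :: "spp \<Rightarrow> rvec \<Rightarrow> rvec \<Rightarrow> ereal" where
  "phi P x y = coupling P x y + regx P x - regy P y"

definition saddle_point :: "spp \<Rightarrow> rvec \<Rightarrow> rvec \<Rightarrow> bool" where
  "saddle_point P x y \<longleftrightarrow> x \<in> domx P \<and> y \<in> domy P \<and>
     (\<forall>u\<in>domx P. \<forall>v\<in>domy P. phi P x v \<le> phi P x y \<and> phi P x y \<le> phi P u y)"

definition eps_saddle_point :: "spp \<Rightarrow> real \<Rightarrow> rvec \<Rightarrow> rvec \<Rightarrow> bool" where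
  "eps_saddle_point P \<epsilon> x y \<longleftrightarrow> x \<in> domx P \<and> y \<in> domy P \<and>
     (\<forall>u\<in>domx P. \<forall>v\<in>domy P. phi P x v - phi P u y \<le> ereal \<epsilon>)"

definition pair_dist :: "nat \<Rightarrow> nat \<Rightarrow> rvec \<times> rvec \<Rightarrow> rvec \<times> rvec \<Rightarrow> real" where
  "pair_dist n m p q =
     sqrt ((enorm n (vdiff (fst p) (fst q)))\<^sup>2 + (enorm m (vdiff (snd p) (snd q)))\<^sup>2)"

definition has_diameter :: "nat \<Rightarrow> nat \<Rightarrow> (rvec \<times> rvec) set \<Rightarrow> real \<Rightarrow> bool" where
  "has_diameter n m S D \<longleftrightarrow>
     bdd_above ((\<lambda>(p, q). pair_dist n m p q) ` (S \<times> S)) \<and>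
     D = (SUP (p, q)\<in>S \<times> S. pair_dist n m p q)"

definition spp_assumptions :: "spp \<Rightarrow> real \<Rightarrow> real \<Rightarrow> bool" where
  "spp_assumptions P M D \<longleftrightarrow>
     (\<forall>v\<in>Rn (dimy P). convex_fun (dimx P) (\<lambda>u. coupling P u v)) \<and>
     (\<forall>u\<in>Rn (dimx P). concave_fun (dimy P) (\<lambda>v. coupling P u v)) \<and>
     proper_lsc_convex (dimx P) (regx P) \<and>
     proper_lsc_convex (dimy P) (regy P) \<and>
     domx P \<times> domy P \<subseteq> dom_coupling P \<and>
     (\<forall>u\<in>domx P. \<forall>v\<in>domy P.
        subgradient (dimx P) (\<lambda>u'. coupling P u' v) u (gradx P u v) \<and>
        supergradient (dimy P) (\<lambda>v'. coupling P u v') v (grady P u v) \<and>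
        enorm (dimx P) (gradx P u v) \<le> M \<and>
        enorm (dimy P) (grady P u v) \<le> M) \<and>
     0 < M \<and>
     has_diameter (dimx P) (dimy P) (domx P \<times> domy P) D \<and>
     0 < D \<and>
     (\<exists>x y. saddle_point P x y)"


section \<open>The modified primal-dual cutting-plane method\<close>

definition linearization ::
    "nat \<Rightarrow> (rvec \<Rightarrow> ereal) \<Rightarrow> (rvec \<Rightarrow> rvec) \<Rightarrow> rvec \<Rightarrow> rvec \<Rightarrow> ereal" where
  "linearization n g g' w u = g w + ereal (dotp n (g' w) (vdiff u w))"

definition prox_reg :: "nat \<Rightarrow> (rvec \<Rightarrow> ereal) \<Rightarrow> real \<Rightarrow> rvec \<Rightarrow> rvec \<Rightarrow> ereal" where
  "prox_reg n h lam w0 u = h u + ereal ((enorm n (vdiff u w0))\<^sup>2 / (2 * lam))"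

definition bundle_update ::
    "nat \<Rightarrow> real \<Rightarrow> (rvec \<Rightarrow> ereal) \<Rightarrow> (rvec \<Rightarrow> rvec) \<Rightarrow> (rvec \<Rightarrow> ereal) \<Rightarrow>
     (rvec \<Rightarrow> real) \<Rightarrow> rvec \<Rightarrow> (rvec \<Rightarrow> real) \<Rightarrow> bool" where
  "bundle_update n M g g' hlam G w G_next \<longleftrightarrow>
     lipschitz_fun n M G_next \<and>
     convex_fun n (\<lambda>u. ereal (G_next u)) \<and>
     (\<forall>u\<in>Rn n. ereal (G_next u) \<le> g u) \<and>
     (\<exists>G_bar. proper_lsc_convex n G_bar \<and>
        (\<forall>u\<in>Rn n. G_bar u \<le> g u) \<and>
        G_bar w = ereal (G w) \<and>
        argmin_on n (\<lambda>u. G_bar u + hlam u) w \<and>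
        (\<forall>u\<in>Rn n. max (G_bar u) (linearization n g g' w u) \<le> ereal (G_next u)))"

definition weighted_avg :: "(nat \<Rightarrow> rvec) \<Rightarrow> nat \<Rightarrow> rvec" where
  "weighted_avg w j =
     (if j = 2 then w 2
      else (\<lambda>c. (3 * w 2 c + (\<Sum>i=3..j. real i * w i c)) / (real j * (real j + 1) / 2)))"

definition pdcp_value ::
    "nat \<Rightarrow> (rvec \<Rightarrow> ereal) \<Rightarrow> real \<Rightarrow> rvec \<Rightarrow> (nat \<Rightarrow> rvec \<Rightarrow> real) \<Rightarrow> (nat \<Rightarrow> rvec) \<Rightarrow> nat \<Rightarrow> ereal"
  where
  "pdcp_value n h lam w0 G w j = ereal (G j (w j)) + prox_reg n h lam w0 (w j)"

definition pdcp_gap ::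
    "nat \<Rightarrow> (rvec \<Rightarrow> ereal) \<Rightarrow> (rvec \<Rightarrow> ereal) \<Rightarrow> real \<Rightarrow> rvec \<Rightarrow>
     (nat \<Rightarrow> rvec \<Rightarrow> real) \<Rightarrow> (nat \<Rightarrow> rvec) \<Rightarrow> nat \<Rightarrow> ereal" where
  "pdcp_gap n g h lam w0 G w j =
     (g (weighted_avg w j) + prox_reg n h lam w0 (weighted_avg w j)) - pdcp_value n h lam w0 G w j"

text \<open>
  The number of iterations is the first index passing the stopping test, and \<open>\<infinity>\<close> (the infimum
  of the empty set) if the call does not terminate.
\<close>

definition pdcp_iters ::
    "nat \<Rightarrow> (rvec \<Rightarrow> ereal) \<Rightarrow> (rvec \<Rightarrow> ereal) \<Rightarrow> rvec \<Rightarrow> real \<Rightarrow> real \<Rightarrow>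
     (nat \<Rightarrow> rvec \<Rightarrow> real) \<Rightarrow> (nat \<Rightarrow> rvec) \<Rightarrow> enat" where
  "pdcp_iters n g h w0 lam \<epsilon> G w =
     (INF j\<in>{j. 2 \<le> j \<and> pdcp_gap n g h lam w0 G w j \<le> ereal \<epsilon>}. enat j)"

text \<open>
  \<open>G j\<close> and \<open>w j\<close> are the model and the iterate of iteration \<open>j \<ge> 1\<close>. They are constrained only
  up to the iteration at which the call stops, so finite executions are covered as they are, and
  a nonterminating call would be an infinite one.
\<close>

definition pdcp_run ::
    "nat \<Rightarrow> real \<Rightarrow> (rvec \<Rightarrow> ereal) \<Rightarrow> (rvec \<Rightarrow> rvec) \<Rightarrow> (rvec \<Rightarrow> ereal) \<Rightarrow> rvec \<Rightarrow> real \<Rightarrow> real \<Rightarrow>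
     (nat \<Rightarrow> rvec \<Rightarrow> real) \<Rightarrow> (nat \<Rightarrow> rvec) \<Rightarrow> bool" where
  "pdcp_run n M g g' h w0 lam \<epsilon> G w \<longleftrightarrow>
     (\<forall>u\<in>Rn n. ereal (G 1 u) = linearization n g g' w0 u) \<and>
     (\<forall>j\<ge>1. enat j \<le> pdcp_iters n g h w0 lam \<epsilon> G w \<longrightarrow>
        argmin_on n (\<lambda>u. ereal (G j u) + prox_reg n h lam w0 u) (w j)) \<and>
     (\<forall>j\<ge>1. enat j < pdcp_iters n g h w0 lam \<epsilon> G w \<longrightarrow>
        bundle_update n M g g' (prox_reg n h lam w0) (G j) (w j) (G (Suc j)))"


section \<open>The modified proximal bundle method for the saddle-point problem\<close>

text \<open>
  Execution data: \<open>modelx k j\<close>, \<open>innerx k j\<close> belong to iteration \<open>j\<close> of the \<open>k\<close>-th call in the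
  variable \<open>x\<close>; \<open>outx k\<close> and \<open>hatx k\<close> are what this call returns (\<open>outx 0\<close> is the starting
  point). Similarly for \<open>y\<close>.
\<close>

record spp_trace =
  modelx :: "nat \<Rightarrow> nat \<Rightarrow> rvec \<Rightarrow> real"
  innerx :: "nat \<Rightarrow> nat \<Rightarrow> rvec"
  outx :: "nat \<Rightarrow> rvec"
  hatx :: "nat \<Rightarrow> rvec"
  modely :: "nat \<Rightarrow> nat \<Rightarrow> rvec \<Rightarrow> real"
  innery :: "nat \<Rightarrow> nat \<Rightarrow> rvec"
  outy :: "nat \<Rightarrow> rvec"
  haty :: "nat \<Rightarrow> rvec"

definition itersx :: "spp \<Rightarrow> (nat \<Rightarrow> real) \<Rightarrow> real \<Rightarrow> spp_trace \<Rightarrow> nat \<Rightarrow> enat" where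
  "itersx P lam \<epsilon> T k =
     pdcp_iters (dimx P) (\<lambda>u. coupling P u (outy T (k - 1))) (regx P)
       (outx T (k - 1)) (lam k) (\<epsilon> / 4) (modelx T k) (innerx T k)"

definition itersy :: "spp \<Rightarrow> (nat \<Rightarrow> real) \<Rightarrow> real \<Rightarrow> spp_trace \<Rightarrow> nat \<Rightarrow> enat" where
  "itersy P lam \<epsilon> T k =
     pdcp_iters (dimy P) (\<lambda>v. - coupling P (outx T (k - 1)) v) (regy P)
       (outy T (k - 1)) (lam k) (\<epsilon> / 4) (modely T k) (innery T k)"

text \<open>The \<open>k\<close>-th pair of calls takes place only if all earlier calls have terminated.\<close>

definition pbspp_run ::
    "spp \<Rightarrow> real \<Rightarrow> (nat \<Rightarrow> real) \<Rightarrow> rvec \<Rightarrow> rvec \<Rightarrow> real \<Rightarrow> spp_trace \<Rightarrow> bool" where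
  "pbspp_run P M lam x0 y0 \<epsilon> T \<longleftrightarrow>
     outx T 0 = x0 \<and> outy T 0 = y0 \<and>
     (\<forall>k\<ge>1. (\<forall>i\<in>{1..<k}. itersx P lam \<epsilon> T i \<noteq> \<infinity> \<and> itersy P lam \<epsilon> T i \<noteq> \<infinity>) \<longrightarrow>
        pdcp_run (dimx P) M
          (\<lambda>u. coupling P u (outy T (k - 1))) (\<lambda>u. gradx P u (outy T (k - 1))) (regx P)
          (outx T (k - 1)) (lam k) (\<epsilon> / 4) (modelx T k) (innerx T k) \<and>
        pdcp_run (dimy P) M
          (\<lambda>v. - coupling P (outx T (k - 1)) v) (\<lambda>v i. - grady P (outx T (k - 1)) v i) (regy P)
          (outy T (k - 1)) (lam k) (\<epsilon> / 4) (modely T k) (innery T k) \<and>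
        (\<forall>j. itersx P lam \<epsilon> T k = enat j \<longrightarrow>
           outx T k = innerx T k j \<and> hatx T k = weighted_avg (innerx T k) j) \<and>
        (\<forall>j. itersy P lam \<epsilon> T k = enat j \<longrightarrow>
           outy T k = innery T k j \<and> haty T k = weighted_avg (innery T k) j))"

definition running_avg :: "(nat \<Rightarrow> rvec) \<Rightarrow> nat \<Rightarrow> rvec" where
  "running_avg z k = (\<lambda>c. (\<Sum>i=1..k. z i c) / real k)"

text \<open>
  The partial sums are nondecreasing in \<open>k\<close>, so the infimum is the total at the first \<open>k\<close> with an
  approximate saddle point. It is \<open>\<infinity>\<close> if there is none, or if a call made before that point
  does not terminate.
\<close>

definition pbspp_total_iters :: "spp \<Rightarrow> (nat \<Rightarrow> real) \<Rightarrow> real \<Rightarrow> spp_trace \<Rightarrow> enat" where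
  "pbspp_total_iters P lam \<epsilon> T =
     (INF k\<in>{k. 1 \<le> k \<and> eps_saddle_point P \<epsilon> (running_avg (hatx T) k) (running_avg (haty T) k)}.
        \<Sum>i=1..k. itersx P lam \<epsilon> T i + itersy P lam \<epsilon> T i)"

end

theory Submission
  imports Defs
begin

text \<open>
  A call of the cutting-plane method computes an inexact proximal step. Minimizers of
  a convex function plus \<open>1 / (2\<lambda>) \<parallel>u - w\<^sub>0\<parallel>\<^sup>2\<close> have quadratic growth
  (\<open>prox_minimizer_quadratic_growth\<close>), and each bundle update keeps this growth through the
  aggregate and adds the linearization at the newest iterate. A convex combination of both lower
  bounds, with weight \<open>2 / (j + 2)\<close>, gives a recursion for the gap between the value at the
  weighted average and the minimum \<open>m\<^sub>j\<close> of the model, with solution at most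
  \<open>12 \<lambda> M\<^sup>2 / (j + 1)\<close> (\<open>gap_bound\<close>). The gap at \<open>j = 2\<close>
  needs an argument of its own, because \<open>w\<^sub>1\<close> can be as far from the prox centre as the domain
  permits; but \<open>w\<^sub>2\<close> is within \<open>2 M \<lambda>\<close> of \<open>w\<^sub>1\<close>, as the two models are
  \<open>M\<close>-Lipschitz (\<open>first_step_bound\<close>). So a call with tolerance \<open>\<epsilon> / 4\<close> takes
  \<open>O(\<lambda> M\<^sup>2 / \<epsilon> + 1)\<close> iterations.

  In the outer iteration both players respond to the previous move of the opponent. By the
  Lipschitz continuity of the coupling, this delay costs \<open>2 M\<close> times the distance moved,
  and after the proximal terms have absorbed the distance, \<open>4 \<lambda>\<^sub>k M\<^sup>2\<close> remains
  (\<open>outer_step\<close>). The other proximal terms telescope with weights \<open>1 / (2\<lambda>\<^sub>k)\<close>.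
  The stepsizes \<open>D / (4 M \<surd>k)\<close> balance the two sums, so that the averaged gap after \<open>K\<close> steps
  is at most \<open>\<epsilon> / 2 + 4 M D / \<surd>K\<close>, and \<open>K\<close> about
  \<open>64 (M D / \<epsilon>)\<^sup>2\<close> suffices (\<open>running_avg_eps_saddle_point\<close>). The \<open>k\<close>-th pair of calls
  takes \<open>O(M D / (\<epsilon> \<surd>k) + 1)\<close> iterations, which sums to
  \<open>O((M D / \<epsilon>) \<surd>K + K)\<close>, the claimed order.
\<close>


section \<open>Convex combinations and distances\<close>

abbreviation mix :: "real \<Rightarrow> rvec \<Rightarrow> rvec \<Rightarrow> rvec" where
  "mix t x y \<equiv> (\<lambda>i. (1 - t) * x i + t * y i)"

abbreviation edist :: "nat \<Rightarrow> rvec \<Rightarrow> rvec \<Rightarrow> real" where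
  "edist n u w \<equiv> enorm n (vdiff u w)"

text \<open>
  The convexity of \<open>S\<close> is part of the predicate because \<open>F\<close> is the real-valued restriction of an
  extended-real function and has no meaning outside \<open>S\<close>: a bound on \<open>F\<close> at a combination is
  useful only together with the fact that the combination stays in \<open>S\<close>.
\<close>

definition mix_convex_on :: "rvec set \<Rightarrow> (rvec \<Rightarrow> real) \<Rightarrow> bool" where
  "mix_convex_on S F \<longleftrightarrow>
     (\<forall>x\<in>S. \<forall>y\<in>S. \<forall>t. 0 < t \<and> t < 1 \<longrightarrow>
        mix t x y \<in> S \<and> F (mix t x y) \<le> (1 - t) * F x + t * F y)"

lemma mix_convex_onD:
  assumes "mix_convex_on S F" "x \<in> S" "y \<in> S" "0 < t" "t < 1"
  shows "mix t x y \<in> S" "F (mix t x y) \<le> (1 - t) * F x + t * F y"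
  using assms unfolding mix_convex_on_def by blast+

lemma mix_convex_on_add:
  assumes "mix_convex_on S F" "mix_convex_on S H"
  shows "mix_convex_on S (\<lambda>u. F u + H u)"
  unfolding mix_convex_on_def
proof (intro ballI allI impI)
  fix x y and t :: real
  assume "x \<in> S" "y \<in> S" "0 < t \<and> t < 1"
  then show "mix t x y \<in> S \<and>
      F (mix t x y) + H (mix t x y) \<le> (1 - t) * (F x + H x) + t * (F y + H y)"
    using mix_convex_onD[OF assms(1), of x y t] mix_convex_onD[OF assms(2), of x y t]
    by (simp add: algebra_simps)
qed

lemma mix_in_Rn: "x \<in> Rn n \<Longrightarrow> y \<in> Rn n \<Longrightarrow> mix t x y \<in> Rn n"
  by (simp add: topspace_Euclidean_space)

lemma enorm_power2: "(enorm n x)\<^sup>2 = (\<Sum>i<n. (x i)\<^sup>2)"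
  by (simp add: enorm_def L2_set_def sum_nonneg)

lemma enorm_nonneg [simp]: "0 \<le> enorm n x"
  by (simp add: enorm_def)

lemma edist_commute: "edist n u w = edist n w u"
proof -
  have "(edist n u w)\<^sup>2 = (edist n w u)\<^sup>2"
    by (simp add: enorm_power2 vdiff_def power2_commute)
  then show ?thesis
    by (simp add: power2_eq_iff_nonneg)
qed

lemma abs_dotp_le: "\<bar>dotp n x y\<bar> \<le> enorm n x * enorm n y"
proof -
  have "\<bar>dotp n x y\<bar> \<le> (\<Sum>i<n. \<bar>x i\<bar> * \<bar>y i\<bar>)"
    unfolding dotp_def by (metis (no_types, lifting) abs_mult sum_abs sum.cong)
  also have "\<dots> \<le> enorm n x * enorm n y"
    unfolding enorm_def by (rule L2_set_mult_ineq)
  finally show ?thesis .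
qed

lemma edist_mix_power2:
  "(edist n (mix t w u) z)\<^sup>2 =
     (1 - t) * (edist n w z)\<^sup>2 + t * (edist n u z)\<^sup>2 - t * (1 - t) * (edist n u w)\<^sup>2"
  unfolding enorm_power2 vdiff_def sum_distrib_left sum.distrib[symmetric] sum_subtractf[symmetric]
  by (rule sum.cong) (auto simp: power2_eq_square algebra_simps)

lemma mix_convex_on_edist_power2:
  assumes "0 < c" and "mix_convex_on S F"
  shows "mix_convex_on S (\<lambda>u. (edist n u z)\<^sup>2 / c)"
  unfolding mix_convex_on_def
proof (intro ballI allI impI conjI)
  fix x y and t :: real
  assume *: "x \<in> S" "y \<in> S" "0 < t \<and> t < 1"
  then show "mix t x y \<in> S"
    using mix_convex_onD(1)[OF assms(2)] by blast
  have "0 \<le> t * (1 - t) * (edist n y x)\<^sup>2"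
    using * by simp
  then have "(edist n (mix t x y) z)\<^sup>2 / c
      \<le> ((1 - t) * (edist n x z)\<^sup>2 + t * (edist n y z)\<^sup>2) / c"
    unfolding edist_mix_power2 using assms(1) by (intro divide_right_mono) auto
  then show "(edist n (mix t x y) z)\<^sup>2 / c
      \<le> (1 - t) * ((edist n x z)\<^sup>2 / c) + t * ((edist n y z)\<^sup>2 / c)"
    by (simp add: add_divide_distrib)
qed

text \<open>
  Comparing the minimizer with a convex combination at parameter \<open>t\<close> gives the claim with the
  last term scaled by \<open>1 - t\<close>, because the square of the distance is exactly quadratic along
  segments; then \<open>t\<close> tends to 0.
\<close>

lemma prox_minimizer_quadratic_growth:
  assumes F: "mix_convex_on S F" and lam: "0 < lam" and w: "w \<in> S" and u: "u \<in> S"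
    and min: "\<And>z. z \<in> S \<Longrightarrow>
      F w + (edist n w c)\<^sup>2 / (2 * lam) \<le> F z + (edist n z c)\<^sup>2 / (2 * lam)"
  shows "F w + (edist n w c)\<^sup>2 / (2 * lam) + (edist n u w)\<^sup>2 / (2 * lam)
    \<le> F u + (edist n u c)\<^sup>2 / (2 * lam)"
proof -
  define a b d where "a = (edist n w c)\<^sup>2 / (2 * lam)" and "b = (edist n u c)\<^sup>2 / (2 * lam)"
    and "d = (edist n u w)\<^sup>2 / (2 * lam)"
  have "d \<le> (F u + b) - (F w + a)"
  proof (rule field_le_mult_one_interval)
    fix z :: real
    assume z: "0 < z" "z < 1"
    define t where "t = 1 - z"
    have t: "0 < t" "t < 1"
      using z by (auto simp: t_def)
    have "F w + a \<le> F (mix t w u) + (edist n (mix t w u) c)\<^sup>2 / (2 * lam)"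
      unfolding a_def by (rule min) (rule mix_convex_onD(1)[OF F w u t])
    also have "(edist n (mix t w u) c)\<^sup>2 / (2 * lam) = (1 - t) * a + t * b - t * (1 - t) * d"
      unfolding edist_mix_power2 a_def b_def d_def
      by (simp add: add_divide_distrib diff_divide_distrib)
    also have "F (mix t w u) \<le> (1 - t) * F w + t * F u"
      by (rule mix_convex_onD(2)[OF F w u t])
    finally have "t * (z * d) \<le> t * ((F u + b) - (F w + a))"
      by (simp add: t_def algebra_simps)
    then show "z * d \<le> (F u + b) - (F w + a)"
      using t by simp
  qed
  then show ?thesis
    by (simp add: a_def b_def d_def)
qed

text \<open>
  Jensen's inequality, from binary combinations: the average of \<open>k + 1\<close> points mixes the new point
  into the average of the first \<open>k\<close> with weight \<open>1 / (k + 1)\<close>.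
\<close>

lemma mix_convex_on_running_avg:
  assumes F: "mix_convex_on S F" and z: "\<And>i. 1 \<le> i \<Longrightarrow> z i \<in> S" and "1 \<le> k"
  shows "running_avg z k \<in> S \<and> F (running_avg z k) \<le> (\<Sum>i=1..k. F (z i)) / real k"
  using \<open>1 \<le> k\<close>
proof (induction k rule: dec_induct)
  case base
  have "running_avg z 1 = z 1"
    by (simp add: running_avg_def)
  then show ?case
    using z by simp
next
  case (step k)
  define t where "t = 1 / real (Suc k)"
  have t: "0 < t" "t < 1" and tk: "1 - t = real k / real (Suc k)"
    using \<open>1 \<le> k\<close> by (auto simp: t_def field_simps)
  have avg: "running_avg z (Suc k) = mix t (running_avg z k) (z (Suc k))"
    unfolding running_avg_def tk using \<open>1 \<le> k\<close>
    by (simp add: t_def add_divide_distrib fun_eq_iff)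
  have "F (running_avg z (Suc k)) \<le> (1 - t) * F (running_avg z k) + t * F (z (Suc k))"
    unfolding avg using step z t by (intro mix_convex_onD(2)[OF F]) auto
  also have "\<dots> \<le> (1 - t) * ((\<Sum>i=1..k. F (z i)) / real k) + t * F (z (Suc k))"
    using step t by (intro add_right_mono mult_left_mono) auto
  also have "\<dots> = (\<Sum>i=1..Suc k. F (z i)) / real (Suc k)"
    unfolding tk using \<open>1 \<le> k\<close> by (simp add: t_def add_divide_distrib)
  finally show ?case
    unfolding avg using step z t mix_convex_onD(1)[OF F] by auto
qed


section \<open>From extended to real values\<close>

lemma edom_subset_Rn: "edom n h \<subseteq> Rn n"
  by (auto simp: edom_def)

lemma proper_ereal_real:
  assumes "proper_lsc_convex n h" "u \<in> edom n h"
  shows "h u = ereal (real_of_ereal (h u))"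
  using assms by (cases "h u") (auto simp: proper_lsc_convex_def proper_fun_def edom_def)

lemma convex_fun_mix:
  assumes "convex_fun n h" "x \<in> Rn n" "y \<in> Rn n" "0 < t" "t < 1" "h x = ereal a" "h y = ereal b"
  shows "h (mix t x y) \<le> ereal ((1 - t) * a + t * b)"
  using assms unfolding convex_fun_def by fastforce

lemma convex_fun_imp_mix_convex_on:
  assumes "convex_fun n g" "S \<subseteq> Rn n" and fin: "\<And>u. u \<in> S \<Longrightarrow> g u = ereal (F u)"
    and S: "\<And>x y t. x \<in> S \<Longrightarrow> y \<in> S \<Longrightarrow> 0 < t \<Longrightarrow> t < 1 \<Longrightarrow> mix t x y \<in> S"
  shows "mix_convex_on S F"
  unfolding mix_convex_on_def
proof (intro ballI allI impI)
  fix x y and t :: real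
  assume *: "x \<in> S" "y \<in> S" "0 < t \<and> t < 1"
  then have "mix t x y \<in> S"
    using S by blast
  moreover have "g (mix t x y) \<le> ereal ((1 - t) * F x + t * F y)"
    using * assms(2) fin by (intro convex_fun_mix[OF assms(1)]) auto
  ultimately show "mix t x y \<in> S \<and> F (mix t x y) \<le> (1 - t) * F x + t * F y"
    using fin by simp
qed

lemma mix_in_edom:
  assumes h: "proper_lsc_convex n h" and "x \<in> edom n h" "y \<in> edom n h" "0 < t" "t < 1"
  shows "mix t x y \<in> edom n h"
proof -
  have "h (mix t x y) \<le> ereal ((1 - t) * real_of_ereal (h x) + t * real_of_ereal (h y))"
    using assms proper_ereal_real[OF h] edom_subset_Rn[of n h]
    by (intro convex_fun_mix) (auto simp: proper_lsc_convex_def)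
  then have "h (mix t x y) < \<infinity>"
    by (rule le_less_trans) simp
  then show ?thesis
    using assms mix_in_Rn[of x n y t] by (simp add: edom_def)
qed

lemma proper_mix_convex_on:
  assumes h: "proper_lsc_convex n h"
  shows "mix_convex_on (edom n h) (\<lambda>u. real_of_ereal (h u))"
  using h by (intro convex_fun_imp_mix_convex_on[of n h])
    (auto simp: proper_lsc_convex_def edom_subset_Rn intro: mix_in_edom[OF h] proper_ereal_real[OF h])

lemma finite_mix_convex_on:
  assumes h: "proper_lsc_convex n h" and g: "convex_fun n g"
    and fin: "\<And>u. u \<in> edom n h \<Longrightarrow> \<bar>g u\<bar> \<noteq> \<infinity>"
  shows "mix_convex_on (edom n h) (\<lambda>u. real_of_ereal (g u))"
  using g by (intro convex_fun_imp_mix_convex_on[of n g])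
    (auto simp: edom_subset_Rn ereal_real fin intro: mix_in_edom[OF h])

lemma bounded_subgradient_lipschitz:
  assumes S: "S \<subseteq> Rn n" and fin: "\<And>u. u \<in> S \<Longrightarrow> g u = ereal (F u)"
    and sub: "\<And>u. u \<in> S \<Longrightarrow> subgradient n g u (g' u) \<and> enorm n (g' u) \<le> M"
    and u: "u \<in> S" and v: "v \<in> S"
  shows "F u - F v \<le> M * edist n u v"
proof -
  have "g u + ereal (dotp n (g' u) (vdiff v u)) \<le> g v"
    using sub[OF u] v S unfolding subgradient_def by blast
  then have "F u - F v \<le> - dotp n (g' u) (vdiff v u)"
    using fin u v by simp
  also have "\<dots> \<le> enorm n (g' u) * edist n v u"
    using abs_dotp_le[of n "g' u" "vdiff v u"] by linarith
  also have "\<dots> \<le> M * edist n v u"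
    using sub[OF u] by (intro mult_right_mono) auto
  finally show ?thesis
    by (simp add: edist_commute)
qed

section \<open>One call of the cutting-plane method\<close>

text \<open>
  Minimizers of model plus regularized \<open>h\<close> are characterized by real inequalities on the domain
  of \<open>h\<close>: any finite value of the objective, here the one at the prox centre, forces the minimizer
  into the domain, where all functions are finite.
\<close>

lemma prox_argmin_quadratic_growth:
  assumes h: "proper_lsc_convex n h" and A: "convex_fun n A"
    and fin: "\<And>u. u \<in> Rn n \<Longrightarrow> A u = ereal (B u)"
    and lam: "0 < lam" and w0: "w0 \<in> edom n h"
    and w: "argmin_on n (\<lambda>u. A u + prox_reg n h lam w0 u) w"
  shows "w \<in> edom n h"
    and "u \<in> edom n h \<Longrightarrow>
      B w + real_of_ereal (h w) + (edist n w w0)\<^sup>2 / (2 * lam) + (edist n u w)\<^sup>2 / (2 * lam)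
      \<le> B u + real_of_ereal (h u) + (edist n u w0)\<^sup>2 / (2 * lam)"
proof -
  have wR: "w \<in> Rn n"
    using w unfolding argmin_on_def is_arg_min_def by blast
  have min: "A w + prox_reg n h lam w0 w \<le> A z + prox_reg n h lam w0 z" if "z \<in> Rn n" for z
    using w that unfolding argmin_on_def is_arg_min_def by (auto simp: not_less)
  have R: "edom n h \<subseteq> Rn n"
    by (rule edom_subset_Rn)
  show wS: "w \<in> edom n h"
  proof (rule ccontr)
    assume "w \<notin> edom n h"
    then have "h w = \<infinity>"
      using wR by (simp add: edom_def)
    then have "A w + prox_reg n h lam w0 w = \<infinity>"
      using fin[OF wR] by (simp add: prox_reg_def)
    moreover have "A w0 + prox_reg n h lam w0 w0 < \<infinity>"
      using fin[of w0] proper_ereal_real[OF h w0] w0 R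
      by (cases "h w0") (auto simp: prox_reg_def)
    ultimately show False
      using min[of w0] w0 R by auto
  qed
  have Bh: "mix_convex_on (edom n h) (\<lambda>u. B u + real_of_ereal (h u))"
    using R fin A
    by (intro mix_convex_on_add proper_mix_convex_on[OF h] convex_fun_imp_mix_convex_on[OF A])
      (auto intro: mix_in_edom[OF h])
  have val: "A z + prox_reg n h lam w0 z
      = ereal (B z + real_of_ereal (h z) + (edist n z w0)\<^sup>2 / (2 * lam))" if z: "z \<in> edom n h" for z
  proof -
    obtain r where "h z = ereal r"
      using proper_ereal_real[OF h z] by blast
    then show ?thesis
      using fin[of z] z R by (auto simp: prox_reg_def)
  qed
  assume u: "u \<in> edom n h"
  show "B w + real_of_ereal (h w) + (edist n w w0)\<^sup>2 / (2 * lam) + (edist n u w)\<^sup>2 / (2 * lam)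
      \<le> B u + real_of_ereal (h u) + (edist n u w0)\<^sup>2 / (2 * lam)"
  proof (rule prox_minimizer_quadratic_growth[OF Bh lam wS u])
    fix z assume z: "z \<in> edom n h"
    then show "B w + real_of_ereal (h w) + (edist n w w0)\<^sup>2 / (2 * lam)
        \<le> B z + real_of_ereal (h z) + (edist n z w0)\<^sup>2 / (2 * lam)"
      using min[of z] R unfolding val[OF wS] val[OF z] by auto
  qed
qed

text \<open>
  The new weight \<open>j + 1\<close> is the fraction \<open>2 / (j + 2)\<close> of the new total
  \<open>(j + 1) * (j + 2) / 2\<close>.
\<close>

lemma weighted_avg_Suc:
  assumes "2 \<le> j"
  shows "weighted_avg w (Suc j) = mix (2 / (real j + 2)) (weighted_avg w j) (w (Suc j))"
proof
  fix c
  have avg: "weighted_avg w i c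
      = (3 * w 2 c + (\<Sum>i=3..i. real i * w i c)) / (real i * (real i + 1) / 2)" if "2 \<le> i" for i
    using that by (auto simp: weighted_avg_def)
  have "(\<Sum>i=3..Suc j. real i * w i c) = (\<Sum>i=3..j. real i * w i c) + real (Suc j) * w (Suc j) c"
    using assms by (simp add: sum.nat_ivl_Suc')
  then show "weighted_avg w (Suc j) c
      = mix (2 / (real j + 2)) (weighted_avg w j) (w (Suc j)) c"
    using assms by (simp add: avg divide_simps) algebra
qed

locale pdcp_call =
  fixes n :: nat and M :: real and g :: "rvec \<Rightarrow> ereal" and g' :: "rvec \<Rightarrow> rvec"
    and h :: "rvec \<Rightarrow> ereal" and w0 :: rvec and lam \<epsilon> :: real
    and G :: "nat \<Rightarrow> rvec \<Rightarrow> real" and w :: "nat \<Rightarrow> rvec"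
  assumes h: "proper_lsc_convex n h"
    and g_convex: "convex_fun n g"
    and g_finite: "\<And>u. u \<in> edom n h \<Longrightarrow> \<bar>g u\<bar> \<noteq> \<infinity>"
    and g_sub: "\<And>u. u \<in> edom n h \<Longrightarrow> subgradient n g u (g' u) \<and> enorm n (g' u) \<le> M"
    and lam: "0 < lam"
    and w0: "w0 \<in> edom n h"
    and run: "pdcp_run n M g g' h w0 lam \<epsilon> G w"
begin

abbreviation S :: "rvec set" where
  "S \<equiv> edom n h"

definition gr :: "rvec \<Rightarrow> real" where
  "gr u = real_of_ereal (g u)"

text \<open>This is \<open>h\<^sup>\<lambda>\<close>, with real values.\<close>

definition hr :: "rvec \<Rightarrow> real" where
  "hr u = real_of_ereal (h u) + (edist n u w0)\<^sup>2 / (2 * lam)"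

definition m :: "nat \<Rightarrow> real" where
  "m j = G j (w j) + hr (w j)"

abbreviation N :: enat where
  "N \<equiv> pdcp_iters n g h w0 lam \<epsilon> G w"

lemma S_Rn: "u \<in> S \<Longrightarrow> u \<in> Rn n"
  using edom_subset_Rn by blast

lemma g_real: "u \<in> S \<Longrightarrow> g u = ereal (gr u)"
  using g_finite by (simp add: gr_def ereal_real)

lemma prox_reg_real: "u \<in> S \<Longrightarrow> prox_reg n h lam w0 u = ereal (hr u)"
  using proper_ereal_real[OF h, of u] by (cases "h u") (auto simp: prox_reg_def hr_def)

lemma M_nonneg: "0 \<le> M"
  using g_sub[OF w0] enorm_nonneg[of n "g' w0"] by linarith

lemma g_lipschitz: "u \<in> S \<Longrightarrow> v \<in> S \<Longrightarrow> gr u - gr v \<le> M * edist n u v"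
  by (rule bounded_subgradient_lipschitz[of S n g gr g'])
    (use edom_subset_Rn g_real g_sub in auto)

lemma linearization_real:
  "v \<in> S \<Longrightarrow> linearization n g g' v u = ereal (gr v + dotp n (g' v) (vdiff u v))"
  using g_real by (simp add: linearization_def)

lemma slope_bound: "v \<in> S \<Longrightarrow> \<bar>dotp n (g' v) x\<bar> \<le> M * enorm n x"
  using abs_dotp_le[of n "g' v" x] g_sub[of v] mult_right_mono[of "enorm n (g' v)" M "enorm n x"]
  by force

lemma model_properties:
  assumes "1 \<le> j" "enat j \<le> N"
  shows "lipschitz_fun n M (G j) \<and> convex_fun n (\<lambda>u. ereal (G j u)) \<and>
    (\<forall>u\<in>Rn n. ereal (G j u) \<le> g u)"
proof (cases "j = 1")
  case True
  have G: "G 1 u = gr w0 + dotp n (g' w0) (vdiff u w0)" if "u \<in> Rn n" for u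
  proof -
    have "ereal (G 1 u) = linearization n g g' w0 u"
      using run that unfolding pdcp_run_def by blast
    then show ?thesis
      by (simp add: linearization_real[OF w0])
  qed
  have "lipschitz_fun n M (G 1)"
    unfolding lipschitz_fun_def
  proof (intro ballI)
    fix u v assume *: "u \<in> Rn n" "v \<in> Rn n"
    have "dotp n (g' w0) (vdiff u w0) - dotp n (g' w0) (vdiff v w0) = dotp n (g' w0) (vdiff u v)"
      unfolding dotp_def vdiff_def sum_subtractf[symmetric]
      by (rule sum.cong) (auto simp: algebra_simps)
    then have "G 1 u - G 1 v = dotp n (g' w0) (vdiff u v)"
      using * by (simp add: G del: One_nat_def)
    then show "\<bar>G 1 u - G 1 v\<bar> \<le> M * edist n u v"
      using slope_bound[OF w0] by simp
  qed
  moreover have "convex_fun n (\<lambda>u. ereal (G 1 u))"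
    unfolding convex_fun_def
  proof (intro ballI allI impI)
    fix x y and t :: real assume *: "x \<in> Rn n" "y \<in> Rn n" "0 < t \<and> t < 1"
    have "dotp n (g' w0) (vdiff (mix t x y) w0)
        = (1 - t) * dotp n (g' w0) (vdiff x w0) + t * dotp n (g' w0) (vdiff y w0)"
      unfolding dotp_def vdiff_def sum_distrib_left sum.distrib[symmetric]
      by (rule sum.cong) (auto simp: algebra_simps)
    then have "G 1 (mix t x y) = (1 - t) * G 1 x + t * G 1 y"
      unfolding G[OF *(1)] G[OF *(2)] G[OF mix_in_Rn[OF *(1,2)]] by (simp add: algebra_simps)
    then show "ereal (G 1 (mix t x y)) \<le> ereal (1 - t) * ereal (G 1 x) + ereal t * ereal (G 1 y)"
      by simp
  qed
  moreover have "ereal (G 1 u) \<le> g u" if "u \<in> Rn n" for u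
    using g_sub[OF w0] that run unfolding subgradient_def pdcp_run_def linearization_def by simp
  ultimately show ?thesis
    using True by simp
next
  case False
  define i where "i = j - 1"
  have i: "j = Suc i" "1 \<le> i"
    using assms(1) False by (auto simp: i_def)
  have "enat i < N"
    using assms(2) i less_le_trans[of "enat i" "enat j" N] by simp
  then have "bundle_update n M g g' (prox_reg n h lam w0) (G i) (w i) (G (Suc i))"
    using run i unfolding pdcp_run_def by blast
  then show ?thesis
    unfolding bundle_update_def i by blast
qed

lemma iterate:
  assumes "1 \<le> j" "enat j \<le> N"
  shows "w j \<in> S"
    and "u \<in> S \<Longrightarrow> m j + (edist n u (w j))\<^sup>2 / (2 * lam) \<le> G j u + hr u"
proof -
  have G: "convex_fun n (\<lambda>u. ereal (G j u))"
    using model_properties[OF assms] by blast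
  have w: "argmin_on n (\<lambda>u. ereal (G j u) + prox_reg n h lam w0 u) (w j)"
    using run assms unfolding pdcp_run_def by blast
  show "w j \<in> S"
    by (rule prox_argmin_quadratic_growth(1)[OF h G refl lam w0 w])
  show "u \<in> S \<Longrightarrow> m j + (edist n u (w j))\<^sup>2 / (2 * lam) \<le> G j u + hr u"
    using prox_argmin_quadratic_growth(2)[OF h G refl lam w0 w, of u] by (simp add: m_def hr_def)
qed

lemma model_le: "1 \<le> j \<Longrightarrow> enat j \<le> N \<Longrightarrow> u \<in> S \<Longrightarrow> G j u \<le> gr u"
  using model_properties[of j] g_real[of u] S_Rn[of u] by fastforce

text \<open>
  The two halves of the maximum in the bundle update. The aggregate \<open>\<Gamma>bar\<close> has the same
  minimizer and minimum as the old model, so it passes on the quadratic growth of the old model.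
\<close>

lemma bundle_step:
  assumes j: "1 \<le> j" "enat j < N" and u: "u \<in> S"
  shows "m j + (edist n u (w j))\<^sup>2 / (2 * lam) \<le> G (Suc j) u + hr u"
    and "gr (w j) + dotp n (g' (w j)) (vdiff u (w j)) \<le> G (Suc j) u"
proof -
  have wj: "w j \<in> S"
    using iterate(1)[of j] j by simp
  obtain A where A: "proper_lsc_convex n A" "A (w j) = ereal (G j (w j))"
      "argmin_on n (\<lambda>u. A u + prox_reg n h lam w0 u) (w j)"
    and le: "\<And>u. u \<in> Rn n \<Longrightarrow> max (A u) (linearization n g g' (w j) u) \<le> ereal (G (Suc j) u)"
    using run j unfolding pdcp_run_def bundle_update_def by blast
  \<comment> \<open>The aggregate lies below a real-valued function, so properness makes it real-valued.\<close>
  have fin: "A z = ereal (real_of_ereal (A z))" if "z \<in> Rn n" for z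
    using A(1) le[OF that] that
    by (cases "A z") (auto simp: proper_lsc_convex_def proper_fun_def)
  have "real_of_ereal (A (w j)) + real_of_ereal (h (w j)) + (edist n (w j) w0)\<^sup>2 / (2 * lam)
      + (edist n u (w j))\<^sup>2 / (2 * lam)
      \<le> real_of_ereal (A u) + real_of_ereal (h u) + (edist n u w0)\<^sup>2 / (2 * lam)"
    using A(1) by (intro prox_argmin_quadratic_growth(2)[OF h _ fin lam w0 A(3) u])
      (auto simp: proper_lsc_convex_def)
  moreover have "real_of_ereal (A u) \<le> G (Suc j) u"
    using le[OF S_Rn[OF u]] fin[OF S_Rn[OF u]] by (cases "A u") auto
  ultimately show "m j + (edist n u (w j))\<^sup>2 / (2 * lam) \<le> G (Suc j) u + hr u"
    using A(2) by (simp add: m_def hr_def)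
  show "gr (w j) + dotp n (g' (w j)) (vdiff u (w j)) \<le> G (Suc j) u"
    using le[OF S_Rn[OF u]] by (simp add: linearization_real[OF wj])
qed

text \<open>
  The new model is at least the linearization at the previous iterate; \<open>g\<close> and that
  linearization agree there and have slopes at most \<open>M\<close>, so they separate at rate at most
  \<open>2 * M\<close>.
\<close>

lemma linearization_error:
  assumes j: "1 \<le> j" "enat j < N"
  shows "gr (w (Suc j)) - 2 * M * edist n (w (Suc j)) (w j) \<le> G (Suc j) (w (Suc j))"
proof -
  have w: "w j \<in> S" "w (Suc j) \<in> S"
    using iterate(1)[of j] iterate(1)[of "Suc j"] j by (auto simp: Suc_ile_eq)
  show ?thesis
    using bundle_step(2)[OF j w(2)] slope_bound[OF w(1), of "vdiff (w (Suc j)) (w j)"]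
      g_lipschitz[OF w(2,1)] by linarith
qed

text \<open>
  Both models are \<open>M\<close>-Lipschitz. Adding the quadratic growth of the two objectives at their
  minimizers cancels \<open>h\<^sup>\<lambda>\<close>, whence the distance of the minimizers is controlled without any
  information on how far \<open>w 1\<close> is from the prox centre.
\<close>

lemma first_step_bound:
  assumes "enat 2 \<le> N"
  shows "edist n (w 2) (w 1) \<le> 2 * M * lam"
proof -
  let ?d = "edist n (w 2) (w 1)"
  have 1: "enat 1 \<le> N"
    using assms order_trans[of "enat 1" "enat 2" N] by simp
  have w: "w 1 \<in> S" "w 2 \<in> S"
    using iterate(1) assms 1 by auto
  have "m 1 + ?d\<^sup>2 / (2 * lam) \<le> G 1 (w 2) + hr (w 2)"
    using iterate(2)[of 1] 1 w by simp
  moreover have "m 2 + ?d\<^sup>2 / (2 * lam) \<le> G 2 (w 1) + hr (w 1)"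
    using iterate(2)[of 2 "w 1"] assms w by (simp add: edist_commute)
  moreover have "G 1 (w 2) - G 1 (w 1) \<le> M * ?d" "G 2 (w 1) - G 2 (w 2) \<le> M * ?d"
    using model_properties[of 1] model_properties[of 2] assms 1 w[THEN S_Rn]
    unfolding lipschitz_fun_def by (metis abs_le_D1 edist_commute one_le_numeral order_refl)+
  ultimately have "?d\<^sup>2 / (2 * lam) + ?d\<^sup>2 / (2 * lam) \<le> 2 * (M * ?d)"
    unfolding m_def by linarith
  then have "?d * ?d \<le> (2 * M * lam) * ?d"
    using lam by (simp add: field_simps power2_eq_square)
  then show ?thesis
  proof (cases "?d = 0")
    case True
    then show ?thesis
      using M_nonneg lam by simp
  next
    case False
    then have "0 < ?d"
      using enorm_nonneg[of n "vdiff (w 2) (w 1)"] by linarith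
    then show ?thesis
      using \<open>?d * ?d \<le> _\<close> by (rule mult_right_le_imp_le[rotated])
  qed
qed

definition gap :: "nat \<Rightarrow> real" where
  "gap j = gr (weighted_avg w j) + hr (weighted_avg w j) - m j"

lemma objective_convex: "mix_convex_on S (\<lambda>u. gr u + hr u)"
  unfolding hr_def gr_def using lam
  by (intro mix_convex_on_add finite_mix_convex_on[OF h g_convex] proper_mix_convex_on[OF h]
      mix_convex_on_edist_power2[of _ S "\<lambda>u. real_of_ereal (h u)"])
    (auto simp: g_finite)

text \<open>
  The new optimal value is bounded below by the convex combination, with weight
  \<open>\<tau> = 2 / (j + 2)\<close>, of the two halves of the bundle update. The linearization error is linear
  in the step length, the growth term quadratic; their difference is at most
  \<open>2 * lam * M\<^sup>2 * \<tau>\<^sup>2 / (1 - \<tau>)\<close> by completing the square. The weighted averages are the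
  convex combinations with the same \<open>\<tau>\<close>, so the gap obeys a recursion whose solution decays
  like \<open>1 / j\<close>.
\<close>

lemma gap_bound:
  assumes "2 \<le> j" "enat j \<le> N"
  shows "weighted_avg w j \<in> S \<and> gap j \<le> 12 * lam * M\<^sup>2 / (real j + 1)"
  using assms
proof (induction j rule: dec_induct)
  case base
  have 1: "enat 1 < N"
    using base less_le_trans[of "enat 1" "enat 2" N] by simp
  have w2: "weighted_avg w 2 = w 2"
    by (simp add: weighted_avg_def)
  have "gr (w 2) - G 2 (w 2) \<le> 2 * M * edist n (w 2) (w 1)"
    using linearization_error[of 1] 1 by (simp add: numeral_2_eq_2)
  also have "\<dots> \<le> 2 * M * (2 * M * lam)"
    using M_nonneg by (intro mult_left_mono first_step_bound base) auto
  finally have "gap 2 \<le> 12 * lam * M\<^sup>2 / (real 2 + 1)"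
    unfolding gap_def m_def w2 by (simp add: power2_eq_square algebra_simps)
  then show ?case
    using iterate(1)[of 2] base w2 by simp
next
  case (step j)
  have j: "1 \<le> j" "enat j < N"
    using step.hyps step.prems by (auto simp: Suc_ile_eq)
  have IH: "weighted_avg w j \<in> S" "gap j \<le> 12 * lam * M\<^sup>2 / (real j + 1)"
    using step.IH j by auto
  have w': "w (Suc j) \<in> S"
    using iterate(1)[of "Suc j"] step.prems by simp
  \<comment> \<open>The weight of the newest iterate in the weighted average.\<close>
  define \<tau> where "\<tau> = 2 / (real j + 2)"
  have \<tau>: "0 < \<tau>" "\<tau> < 1"
    using j by (auto simp: \<tau>_def)
  have avg: "weighted_avg w (Suc j) = mix \<tau> (weighted_avg w j) (w (Suc j))"
    unfolding \<tau>_def by (rule weighted_avg_Suc) fact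
  define d where "d = edist n (w (Suc j)) (w j)"
  let ?F = "\<lambda>u. gr u + hr u"
  have a: "m j + d\<^sup>2 / (2 * lam) \<le> m (Suc j)"
    unfolding d_def m_def[of "Suc j"] by (rule bundle_step(1)[OF j w'])
  have b: "?F (w (Suc j)) - 2 * M * d \<le> m (Suc j)"
    using linearization_error[OF j] by (simp add: m_def d_def)
  have "(1 - \<tau>) * (m j + d\<^sup>2 / (2 * lam)) + \<tau> * (?F (w (Suc j)) - 2 * M * d)
      \<le> (1 - \<tau>) * m (Suc j) + \<tau> * m (Suc j)"
    using \<tau> a b by (intro add_mono mult_left_mono) auto
  moreover have "?F (weighted_avg w (Suc j))
      \<le> (1 - \<tau>) * ?F (weighted_avg w j) + \<tau> * ?F (w (Suc j))"
    unfolding avg by (rule mix_convex_onD(2)[OF objective_convex IH(1) w' \<tau>])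
  ultimately have "gap (Suc j)
      \<le> (1 - \<tau>) * gap j + (2 * M * \<tau> * d - (1 - \<tau>) * (d\<^sup>2 / (2 * lam)))"
    by (simp add: gap_def algebra_simps)
  also have "2 * M * \<tau> * d - (1 - \<tau>) * (d\<^sup>2 / (2 * lam)) \<le> 2 * lam * M\<^sup>2 * \<tau>\<^sup>2 / (1 - \<tau>)"
  proof -
    have "2 * lam * M\<^sup>2 * \<tau>\<^sup>2 / (1 - \<tau>) - (2 * M * \<tau> * d - (1 - \<tau>) * (d\<^sup>2 / (2 * lam)))
        = (2 * lam * M * \<tau> - (1 - \<tau>) * d)\<^sup>2 / (2 * lam * (1 - \<tau>))"
      using lam \<tau> by (simp add: field_simps power2_eq_square)
    also have "\<dots> \<ge> 0"
      using lam \<tau> by simp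
    finally show ?thesis
      by simp
  qed
  also have "(1 - \<tau>) * gap j \<le> (1 - \<tau>) * (12 * lam * M\<^sup>2 / (real j + 1))"
    using IH(2) \<tau> by (intro mult_left_mono) auto
  also have "1 - \<tau> = real j / (real j + 2)"
    by (simp add: \<tau>_def field_simps)
  also have "real j / (real j + 2) * (12 * lam * M\<^sup>2 / (real j + 1)) + 2 * lam * M\<^sup>2 * \<tau>\<^sup>2 / (real j / (real j + 2))
      = lam * M\<^sup>2 * (12 * real j / ((real j + 1) * (real j + 2)) + 8 / (real j * (real j + 2)))"
    using \<open>2 \<le> j\<close> by (simp add: \<tau>_def divide_simps power2_eq_square) algebra
  also have "\<dots> \<le> lam * M\<^sup>2 * (12 / (real j + 2))"
  proof (intro mult_left_mono)
    have "8 / real j \<le> 12 / (real j + 1)"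
      using \<open>2 \<le> j\<close> by (simp add: field_simps)
    then have "8 / real j / (real j + 2) \<le> 12 / (real j + 1) / (real j + 2)"
      by (intro divide_right_mono) auto
    moreover have "12 * real j / ((real j + 1) * (real j + 2)) + 12 / (real j + 1) / (real j + 2)
        = 12 / (real j + 2)"
      by (simp add: divide_simps)
    ultimately show "12 * real j / ((real j + 1) * (real j + 2)) + 8 / (real j * (real j + 2))
        \<le> 12 / (real j + 2)"
      unfolding divide_divide_eq_left by linarith
  qed (use lam in simp)
  also have "\<dots> = 12 * lam * M\<^sup>2 / (real (Suc j) + 1)"
    by (simp add: field_simps)
  finally have "gap (Suc j) \<le> 12 * lam * M\<^sup>2 / (real (Suc j) + 1)"
    by simp
  moreover have "weighted_avg w (Suc j) \<in> S"
    unfolding avg by (rule mix_convex_onD(1)[OF objective_convex IH(1) w' \<tau>])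
  ultimately show ?case
    by blast
qed

lemma pdcp_gap_real:
  assumes "2 \<le> j" "enat j \<le> N"
  shows "pdcp_gap n g h lam w0 G w j = ereal (gap j)"
proof -
  have "weighted_avg w j \<in> S" "w j \<in> S"
    using gap_bound[OF assms] iterate(1)[of j] assms by auto
  then show ?thesis
    by (simp add: pdcp_gap_def pdcp_value_def gap_def m_def prox_reg_real g_real)
qed

text \<open>
  Were there more iterations, the bound on the gap would still hold at the stated index, where
  it is below the tolerance.
\<close>

lemma iteration_bound:
  assumes "0 < \<epsilon>"
  shows "N \<le> enat (nat \<lceil>12 * lam * M\<^sup>2 / \<epsilon>\<rceil> + 2)"
proof (rule ccontr)
  define J where "J = nat \<lceil>12 * lam * M\<^sup>2 / \<epsilon>\<rceil> + 2"
  assume "\<not> N \<le> enat (nat \<lceil>12 * lam * M\<^sup>2 / \<epsilon>\<rceil> + 2)"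
  then have J: "enat J < N" "2 \<le> J"
    by (auto simp: J_def)
  have "12 * lam * M\<^sup>2 / \<epsilon> \<le> real J + 1"
    unfolding J_def by (simp add: le_nat_iff) linarith
  then have "12 * lam * M\<^sup>2 / (real J + 1) \<le> \<epsilon>"
    using assms by (simp add: field_simps)
  then have "gap J \<le> \<epsilon>"
    using gap_bound[of J] J by force
  then have "pdcp_gap n g h lam w0 G w J \<le> ereal \<epsilon>"
    using pdcp_gap_real[of J] J by simp
  then have "N \<le> enat J"
    unfolding pdcp_iters_def using J by (intro INF_lower) simp
  then show False
    using J by simp
qed

text \<open>A finite infimum of natural numbers is attained, so the call ends at an index passing the test.\<close>

lemma stopping_test:
  assumes "N = enat j"
  shows "2 \<le> j" "gap j \<le> \<epsilon>"
proof -
  let ?T = "{j. 2 \<le> j \<and> pdcp_gap n g h lam w0 G w j \<le> ereal \<epsilon>}"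
  have N: "N = Inf (enat ` ?T)"
    by (simp add: pdcp_iters_def)
  have "?T \<noteq> {}"
  proof
    assume "?T = {}"
    then have "N = \<infinity>"
      by (simp only: N \<open>?T = {}\<close>) (simp add: top_enat_def)
    then show False
      using assms by simp
  qed
  then obtain i where "enat i \<in> enat ` ?T"
    by blast
  then have "Inf (enat ` ?T) \<in> enat ` ?T"
    by (rule wellorder_InfI)
  then have "j \<in> ?T"
    using assms N by auto
  then show "2 \<le> j" "gap j \<le> \<epsilon>"
    using pdcp_gap_real[of j] assms by auto
qed

lemma output_in_domain:
  assumes "N = enat j"
  shows "w j \<in> S" "weighted_avg w j \<in> S"
  using stopping_test(1)[OF assms] assms iterate(1)[of j] gap_bound[of j] by auto

text \<open>
  The returned pair is an inexact proximal point: \<open>weighted_avg w j\<close> carries the objective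
  value, \<open>w j\<close> the quadratic growth.
\<close>

lemma output_inequality:
  assumes "N = enat j" and u: "u \<in> S"
  shows "real_of_ereal (g (weighted_avg w j)) + real_of_ereal (h (weighted_avg w j))
      + (edist n (weighted_avg w j) w0)\<^sup>2 / (2 * lam) + (edist n u (w j))\<^sup>2 / (2 * lam)
    \<le> real_of_ereal (g u) + real_of_ereal (h u) + (edist n u w0)\<^sup>2 / (2 * lam) + \<epsilon>"
proof -
  have j: "1 \<le> j" "enat j \<le> N"
    using stopping_test(1)[OF assms(1)] assms(1) by auto
  show ?thesis
    using stopping_test(2)[OF assms(1)] iterate(2)[OF j u] model_le[OF j u]
    by (simp add: gap_def hr_def gr_def)
qed

end

section \<open>The outer iteration\<close>

lemma sum_inverse_sqrt_le: "(\<Sum>k=1..K. 1 / sqrt (real k)) \<le> 2 * sqrt (real K)"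
proof (induction K)
  case (Suc K)
  define a b where "a = sqrt (real (Suc K))" and "b = sqrt (real K)"
  have "a\<^sup>2 = b\<^sup>2 + 1" "0 < a"
    by (auto simp: a_def b_def)
  moreover have "0 \<le> (a - b)\<^sup>2"
    by simp
  ultimately have "1 / a \<le> 2 * a - 2 * b"
    by (simp add: field_simps power2_eq_square)
  then show ?case
    using Suc by (simp add: a_def b_def)
qed simp

text \<open>
  A telescoping sum with nondecreasing weights: each increase of the weight is paid for by the
  bound on the sequence.
\<close>

lemma weighted_telescope_le:
  fixes c E :: "nat \<Rightarrow> real"
  assumes c: "\<And>k. 1 \<le> k \<Longrightarrow> c k \<le> c (Suc k)" "0 \<le> c 1" and E: "\<And>k. E k \<le> B" and "1 \<le> K"
  shows "(\<Sum>k=1..K. c k * (E (k - 1) - E k)) \<le> c K * (B - E K)"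
  using \<open>1 \<le> K\<close>
proof (induction K rule: dec_induct)
  case base
  show ?case
    using mult_left_mono[OF E[of 0] c(2)] by (simp add: algebra_simps)
next
  case (step K)
  have "c K * (B - E K) \<le> c (Suc K) * (B - E K)"
    using c(1)[OF \<open>1 \<le> K\<close>] E[of K] by (intro mult_right_mono) auto
  then show ?case
    using step.IH by (simp add: algebra_simps)
qed

lemma enat_sum: "(\<Sum>i\<in>A. enat (F i)) = enat (\<Sum>i\<in>A. F i)"
  by (simp add: of_nat_eq_enat[symmetric])

lemma supergradient_uminus:
  assumes s: "supergradient n c v s" and fin: "\<bar>c v\<bar> \<noteq> \<infinity>"
  shows "subgradient n (\<lambda>v. - c v) v (\<lambda>i. - s i)"
proof -
  obtain r where r: "c v = ereal r"
    using fin by (cases "c v") auto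
  have "- c v + ereal (dotp n (\<lambda>i. - s i) (vdiff v' v)) \<le> - c v'" if "v' \<in> Rn n" for v'
  proof -
    have "c v' \<le> ereal (r + dotp n s (vdiff v' v))"
      using s that r by (simp add: supergradient_def)
    moreover have "dotp n (\<lambda>i. - s i) (vdiff v' v) = - dotp n s (vdiff v' v)"
      by (simp add: dotp_def sum_negf)
    ultimately show ?thesis
      using r by (cases "c v'") auto
  qed
  then show ?thesis
    using s by (simp add: subgradient_def supergradient_def topspace_Euclidean_space)
qed

lemma enorm_uminus: "enorm n (\<lambda>i. - s i) = enorm n s"
  by (simp add: enorm_def L2_set_def)

locale pbspp_execution =
  fixes P :: spp and M D :: real and x0 y0 :: rvec and \<epsilon> :: real
    and lam :: "nat \<Rightarrow> real" and T :: spp_trace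
  assumes asm: "spp_assumptions P M D"
    and x0: "x0 \<in> domx P" and y0: "y0 \<in> domy P"
    and eps: "0 < \<epsilon>"
    and lam1: "lam 1 = D / (4 * M)"
    and lamk: "\<And>k. 1 \<le> k \<Longrightarrow> lam k = lam 1 / sqrt (real k)"
    and run: "pbspp_run P M lam x0 y0 \<epsilon> T"
begin

definition f :: "rvec \<Rightarrow> rvec \<Rightarrow> real" where
  "f u v = real_of_ereal (coupling P u v)"

definition h1 :: "rvec \<Rightarrow> real" where
  "h1 u = real_of_ereal (regx P u)"

definition h2 :: "rvec \<Rightarrow> real" where
  "h2 v = real_of_ereal (regy P v)"

abbreviation distx :: "rvec \<Rightarrow> rvec \<Rightarrow> real" where
  "distx \<equiv> edist (dimx P)"

abbreviation disty :: "rvec \<Rightarrow> rvec \<Rightarrow> real" where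
  "disty \<equiv> edist (dimy P)"

lemma M_pos: "0 < M" and D_pos: "0 < D"
  using asm by (auto simp: spp_assumptions_def)

lemma regx: "proper_lsc_convex (dimx P) (regx P)"
  and regy: "proper_lsc_convex (dimy P) (regy P)"
  using asm by (auto simp: spp_assumptions_def)

lemma coupling_finite:
  assumes "u \<in> domx P" "v \<in> domy P"
  shows "\<bar>coupling P u v\<bar> \<noteq> \<infinity>"
proof -
  have "(u, v) \<in> dom_coupling P"
    using asm assms unfolding spp_assumptions_def by blast
  then show ?thesis
    by (simp add: dom_coupling_def)
qed

lemma coupling_real: "u \<in> domx P \<Longrightarrow> v \<in> domy P \<Longrightarrow> coupling P u v = ereal (f u v)"
  using coupling_finite by (simp add: f_def ereal_real)

lemma regx_real: "u \<in> domx P \<Longrightarrow> regx P u = ereal (h1 u)"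
  unfolding h1_def by (rule proper_ereal_real[OF regx])

lemma regy_real: "v \<in> domy P \<Longrightarrow> regy P v = ereal (h2 v)"
  unfolding h2_def by (rule proper_ereal_real[OF regy])

lemma coupling_convex: "v \<in> domy P \<Longrightarrow> convex_fun (dimx P) (\<lambda>u. coupling P u v)"
  and coupling_concave: "u \<in> domx P \<Longrightarrow> convex_fun (dimy P) (\<lambda>v. - coupling P u v)"
  using asm edom_subset_Rn unfolding spp_assumptions_def concave_fun_def by blast+

lemma gradx:
  assumes "u \<in> domx P" "v \<in> domy P"
  shows "subgradient (dimx P) (\<lambda>u. coupling P u v) u (gradx P u v)
    \<and> enorm (dimx P) (gradx P u v) \<le> M"
  using asm assms unfolding spp_assumptions_def by blast

lemma grady:
  assumes "u \<in> domx P" "v \<in> domy P"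
  shows "subgradient (dimy P) (\<lambda>v. - coupling P u v) v (\<lambda>i. - grady P u v i)
    \<and> enorm (dimy P) (\<lambda>i. - grady P u v i) \<le> M"
  using asm assms supergradient_uminus[of "dimy P" "\<lambda>v. coupling P u v", OF _ coupling_finite[OF assms]]
  unfolding spp_assumptions_def enorm_uminus by blast

lemma f_lipschitz_x:
  "u \<in> domx P \<Longrightarrow> u' \<in> domx P \<Longrightarrow> v \<in> domy P \<Longrightarrow> f u v - f u' v \<le> M * distx u u'"
  by (rule bounded_subgradient_lipschitz[of "domx P" "dimx P" "\<lambda>u. coupling P u v"
        "\<lambda>u. f u v" "\<lambda>u. gradx P u v"])
    (use edom_subset_Rn gradx coupling_real in auto)

lemma f_lipschitz_y:
  assumes "u \<in> domx P" "v \<in> domy P" "v' \<in> domy P"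
  shows "f u v - f u v' \<le> M * disty v v'"
proof -
  have "- f u v' - - f u v \<le> M * disty v' v"
    by (rule bounded_subgradient_lipschitz[of "domy P" "dimy P" "\<lambda>v. - coupling P u v"
        "\<lambda>v. - f u v" "\<lambda>v i. - grady P u v i"])
      (use edom_subset_Rn grady[OF assms(1)] coupling_real assms in auto)
  then show ?thesis
    by (simp add: edist_commute)
qed

lemma diameter_bound:
  assumes "u \<in> domx P" "u' \<in> domx P" "v \<in> domy P" "v' \<in> domy P"
  shows "(distx u u')\<^sup>2 + (disty v v')\<^sup>2 \<le> D\<^sup>2"
proof -
  have D: "bdd_above ((\<lambda>(p, q). pair_dist (dimx P) (dimy P) p q)
        ` ((domx P \<times> domy P) \<times> (domx P \<times> domy P)))"
      "D = (SUP (p, q)\<in>(domx P \<times> domy P) \<times> (domx P \<times> domy P).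
        pair_dist (dimx P) (dimy P) p q)"
    using asm unfolding spp_assumptions_def has_diameter_def by auto
  have "pair_dist (dimx P) (dimy P) (u, v) (u', v') \<le> D"
    using cSUP_upper[OF _ D(1), of "((u, v), (u', v'))"] assms unfolding D(2) by auto
  then have "sqrt ((distx u u')\<^sup>2 + (disty v v')\<^sup>2) \<le> D"
    by (simp add: pair_dist_def)
  then show ?thesis
    using D_pos by (simp add: real_sqrt_le_iff' real_le_lsqrt sqrt_le_D)
qed

lemma lam_formula: "1 \<le> k \<Longrightarrow> lam k = D / (4 * M * sqrt (real k))"
  using lamk[of k] lam1 by simp

lemma lam_pos: "1 \<le> k \<Longrightarrow> 0 < lam k"
  using lam_formula[of k] M_pos D_pos by simp

definition terminated_before :: "nat \<Rightarrow> bool" where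
  "terminated_before k \<longleftrightarrow>
     (\<forall>i\<in>{1..<k}. itersx P lam \<epsilon> T i \<noteq> \<infinity> \<and> itersy P lam \<epsilon> T i \<noteq> \<infinity>)"

lemma calls:
  assumes k: "1 \<le> k" "terminated_before k"
    and out: "outx T (k - 1) \<in> domx P" "outy T (k - 1) \<in> domy P"
  shows "pdcp_call (dimx P) M (\<lambda>u. coupling P u (outy T (k - 1)))
      (\<lambda>u. gradx P u (outy T (k - 1))) (regx P) (outx T (k - 1)) (lam k) (\<epsilon> / 4)
      (modelx T k) (innerx T k)"
    and "pdcp_call (dimy P) M (\<lambda>v. - coupling P (outx T (k - 1)) v)
      (\<lambda>v i. - grady P (outx T (k - 1)) v i) (regy P) (outy T (k - 1)) (lam k) (\<epsilon> / 4)
      (modely T k) (innery T k)"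
  using k out run regx regy lam_pos[OF k(1)] coupling_convex coupling_concave coupling_finite
    gradx grady
  by (auto simp: pdcp_call_def pbspp_run_def terminated_before_def)

lemma outputs:
  assumes k: "1 \<le> k" "terminated_before k"
  shows "itersx P lam \<epsilon> T k = enat j \<Longrightarrow>
      outx T k = innerx T k j \<and> hatx T k = weighted_avg (innerx T k) j"
    and "itersy P lam \<epsilon> T k = enat j \<Longrightarrow>
      outy T k = innery T k j \<and> haty T k = weighted_avg (innery T k) j"
  using k run by (auto simp: pbspp_run_def terminated_before_def)

abbreviation call_bound :: "nat \<Rightarrow> nat" where
  "call_bound k \<equiv> nat \<lceil>12 * lam k * M\<^sup>2 / (\<epsilon> / 4)\<rceil> + 2"

lemma call_iterations:
  assumes k: "1 \<le> k" "terminated_before k"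
    and out: "outx T (k - 1) \<in> domx P" "outy T (k - 1) \<in> domy P"
  shows "itersx P lam \<epsilon> T k \<le> enat (call_bound k)"
    and "itersy P lam \<epsilon> T k \<le> enat (call_bound k)"
  unfolding itersx_def itersy_def using eps
  by (intro pdcp_call.iteration_bound[OF calls(1)[OF assms]]
      pdcp_call.iteration_bound[OF calls(2)[OF assms]]; simp)+

text \<open>
  The calls of step \<open>k\<close> are known to be cutting-plane runs only if the earlier ones have
  terminated, and to have a finite iteration count only if their prox centres lie in the domains.
  So termination and feasibility of the iterates are carried through one induction.
\<close>

lemma all_calls_terminate:
  "terminated_before (Suc k) \<and> outx T k \<in> domx P \<and> outy T k \<in> domy P"
proof (induction k)
  case 0
  show ?case
    using run x0 y0 by (simp add: pbspp_run_def terminated_before_def)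
next
  case (Suc k)
  let ?k = "Suc k"
  have prem: "1 \<le> ?k" "terminated_before ?k" "outx T (?k - 1) \<in> domx P" "outy T (?k - 1) \<in> domy P"
    using Suc by auto
  obtain i where i: "itersx P lam \<epsilon> T ?k = enat i"
    using call_iterations(1)[OF prem] by (cases "itersx P lam \<epsilon> T ?k") auto
  obtain j where j: "itersy P lam \<epsilon> T ?k = enat j"
    using call_iterations(2)[OF prem] by (cases "itersy P lam \<epsilon> T ?k") auto
  have "outx T ?k \<in> domx P"
    using pdcp_call.output_in_domain(1)[OF calls(1)[OF prem] i[unfolded itersx_def]]
      outputs(1)[OF prem(1,2) i] by simp
  moreover have "outy T ?k \<in> domy P"
    using pdcp_call.output_in_domain(1)[OF calls(2)[OF prem] j[unfolded itersy_def]]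
      outputs(2)[OF prem(1,2) j] by simp
  moreover have "terminated_before (Suc ?k)"
    using prem(2) i j by (auto simp: terminated_before_def less_Suc_eq)
  ultimately show ?case
    by blast
qed

lemma out_in_domain: "outx T k \<in> domx P" "outy T k \<in> domy P"
  using all_calls_terminate by blast+

lemma terminated: "1 \<le> k \<Longrightarrow> terminated_before k"
  using all_calls_terminate[of "k - 1"] by simp

lemma iterations_le:
  assumes "1 \<le> k"
  shows "itersx P lam \<epsilon> T k + itersy P lam \<epsilon> T k \<le> enat (2 * call_bound k)"
proof -
  have "itersx P lam \<epsilon> T k + itersy P lam \<epsilon> T k \<le> enat (call_bound k) + enat (call_bound k)"
    by (intro add_mono call_iterations assms terminated out_in_domain)
  then show ?thesis
    by (simp add: mult_2)
qed

lemma call_results: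
  assumes k: "1 \<le> k"
  shows "hatx T k \<in> domx P" and "haty T k \<in> domy P"
    and "u \<in> domx P \<Longrightarrow>
      f (hatx T k) (outy T (k - 1)) + h1 (hatx T k)
      + (distx (hatx T k) (outx T (k - 1)))\<^sup>2 / (2 * lam k) + (distx u (outx T k))\<^sup>2 / (2 * lam k)
      \<le> f u (outy T (k - 1)) + h1 u + (distx u (outx T (k - 1)))\<^sup>2 / (2 * lam k) + \<epsilon> / 4"
    and "v \<in> domy P \<Longrightarrow>
      - f (outx T (k - 1)) (haty T k) + h2 (haty T k)
      + (disty (haty T k) (outy T (k - 1)))\<^sup>2 / (2 * lam k) + (disty v (outy T k))\<^sup>2 / (2 * lam k)
      \<le> - f (outx T (k - 1)) v + h2 v + (disty v (outy T (k - 1)))\<^sup>2 / (2 * lam k) + \<epsilon> / 4"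
proof -
  note prem = k terminated[OF k] out_in_domain[of "k - 1"]
  obtain i where i: "itersx P lam \<epsilon> T k = enat i"
    using call_iterations(1)[OF prem] by (cases "itersx P lam \<epsilon> T k") auto
  obtain j where j: "itersy P lam \<epsilon> T k = enat j"
    using call_iterations(2)[OF prem] by (cases "itersy P lam \<epsilon> T k") auto
  note X = outputs(1)[OF prem(1,2) i] and Y = outputs(2)[OF prem(1,2) j]
  show "hatx T k \<in> domx P"
    using pdcp_call.output_in_domain(2)[OF calls(1)[OF prem] i[unfolded itersx_def]] X by simp
  show "haty T k \<in> domy P"
    using pdcp_call.output_in_domain(2)[OF calls(2)[OF prem] j[unfolded itersy_def]] Y by simp
  show "u \<in> domx P \<Longrightarrow>
      f (hatx T k) (outy T (k - 1)) + h1 (hatx T k)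
      + (distx (hatx T k) (outx T (k - 1)))\<^sup>2 / (2 * lam k) + (distx u (outx T k))\<^sup>2 / (2 * lam k)
      \<le> f u (outy T (k - 1)) + h1 u + (distx u (outx T (k - 1)))\<^sup>2 / (2 * lam k) + \<epsilon> / 4"
    using pdcp_call.output_inequality[OF calls(1)[OF prem] i[unfolded itersx_def], of u] X
    by (simp add: f_def h1_def)
  show "v \<in> domy P \<Longrightarrow>
      - f (outx T (k - 1)) (haty T k) + h2 (haty T k)
      + (disty (haty T k) (outy T (k - 1)))\<^sup>2 / (2 * lam k) + (disty v (outy T k))\<^sup>2 / (2 * lam k)
      \<le> - f (outx T (k - 1)) v + h2 v + (disty v (outy T (k - 1)))\<^sup>2 / (2 * lam k) + \<epsilon> / 4"
    using pdcp_call.output_inequality[OF calls(2)[OF prem] j[unfolded itersy_def], of v] Y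
    by (simp add: f_def h2_def)
qed

definition sqdist_to_out :: "rvec \<Rightarrow> rvec \<Rightarrow> nat \<Rightarrow> real" where
  "sqdist_to_out u v k = (distx u (outx T k))\<^sup>2 + (disty v (outy T k))\<^sup>2"

text \<open>
  Adding the inequalities of the two calls gives this estimate, except that the coupling is
  evaluated at the previous iterate of the opponent. Replacing these iterates in all terms changes
  the coupling by at most \<open>2 * M\<close> times the distance of each new point from its prox centre, which
  the proximal terms compensate up to \<open>2 * lam k * M\<^sup>2\<close> for each player.
\<close>

lemma outer_step:
  assumes k: "1 \<le> k" and u: "u \<in> domx P" and v: "v \<in> domy P"
  shows "(f (hatx T k) v + h1 (hatx T k)) + (- f u (haty T k) + h2 (haty T k)) - (h1 u + h2 v)
    \<le> \<epsilon> / 2 + 4 * lam k * M\<^sup>2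
      + 1 / (2 * lam k) * (sqdist_to_out u v (k - 1) - sqdist_to_out u v k)"
proof -
  note hx = call_results(1)[OF k] and hy = call_results(2)[OF k]
  note ox = out_in_domain(1)[of "k - 1"] and oy = out_in_domain(2)[of "k - 1"]
  define a b where "a = distx (hatx T k) (outx T (k - 1))" and "b = disty (haty T k) (outy T (k - 1))"
  have L: "f (hatx T k) v - f (outx T (k - 1)) v \<le> M * a"
    "f (outx T (k - 1)) (haty T k) - f (hatx T k) (haty T k) \<le> M * a"
    "f (hatx T k) (haty T k) - f (hatx T k) (outy T (k - 1)) \<le> M * b"
    "f u (outy T (k - 1)) - f u (haty T k) \<le> M * b"
    using f_lipschitz_x[OF hx ox v] f_lipschitz_x[OF ox hx hy] f_lipschitz_y[OF hx hy oy]
      f_lipschitz_y[OF u oy hy] by (simp_all add: a_def b_def edist_commute)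
  have sq: "2 * (M * c) \<le> 2 * lam k * M\<^sup>2 + c\<^sup>2 / (2 * lam k)" for c
  proof -
    have "2 * lam k * M\<^sup>2 + c\<^sup>2 / (2 * lam k) - 2 * (M * c) = (2 * lam k * M - c)\<^sup>2 / (2 * lam k)"
      using lam_pos[OF k] by (simp add: field_simps power2_eq_square)
    also have "\<dots> \<ge> 0"
      using lam_pos[OF k] by simp
    finally show ?thesis
      by simp
  qed
  have "1 / (2 * lam k) * (sqdist_to_out u v (k - 1) - sqdist_to_out u v k)
      = (distx u (outx T (k - 1)))\<^sup>2 / (2 * lam k) + (disty v (outy T (k - 1)))\<^sup>2 / (2 * lam k)
      - (distx u (outx T k))\<^sup>2 / (2 * lam k) - (disty v (outy T k))\<^sup>2 / (2 * lam k)"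
    by (simp add: sqdist_to_out_def add_divide_distrib diff_divide_distrib)
  then show ?thesis
    using call_results(3)[OF k u] call_results(4)[OF k v] L sq[of a] sq[of b]
    unfolding a_def[symmetric] b_def[symmetric] by linarith
qed

text \<open>
  With \<open>lam k = D / (4 * M * sqrt k)\<close>, the accumulated errors \<open>4 * lam k * M\<^sup>2\<close> and the telescoping
  sum contribute \<open>2 * M * D * sqrt K\<close> each.
\<close>

lemma sum_outer_steps:
  assumes K: "1 \<le> K" and u: "u \<in> domx P" and v: "v \<in> domy P"
  shows "(\<Sum>k=1..K. (f (hatx T k) v + h1 (hatx T k)) + (- f u (haty T k) + h2 (haty T k)) - (h1 u + h2 v))
    \<le> real K * (\<epsilon> / 2) + 4 * M * D * sqrt (real K)"
proof -
  define E where "E = sqdist_to_out u v"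
  \<comment> \<open>This is \<open>1 / (2 * lam k)\<close> for \<open>k\<close> at least 1.\<close>
  define c where "c k = 2 * M * sqrt (real k) / D" for k
  have "(\<Sum>k=1..K. (f (hatx T k) v + h1 (hatx T k)) + (- f u (haty T k) + h2 (haty T k)) - (h1 u + h2 v))
    \<le> (\<Sum>k=1..K. \<epsilon> / 2 + M * D * (1 / sqrt (real k)) + c k * (E (k - 1) - E k))"
  proof (rule sum_mono)
    fix k assume "k \<in> {1..K}"
    then have k: "1 \<le> k"
      by simp
    have "4 * lam k * M\<^sup>2 = M * D * (1 / sqrt (real k))" "1 / (2 * lam k) = c k"
      using M_pos D_pos k by (auto simp: lam_formula[OF k] c_def power2_eq_square)
    then show "(f (hatx T k) v + h1 (hatx T k)) + (- f u (haty T k) + h2 (haty T k)) - (h1 u + h2 v)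
      \<le> \<epsilon> / 2 + M * D * (1 / sqrt (real k)) + c k * (E (k - 1) - E k)"
      using outer_step[OF k u v] by (simp only: E_def)
  qed
  also have "\<dots> = real K * (\<epsilon> / 2) + M * D * (\<Sum>k=1..K. 1 / sqrt (real k))
      + (\<Sum>k=1..K. c k * (E (k - 1) - E k))"
    by (simp add: sum.distrib sum_distrib_left)
  also have "M * D * (\<Sum>k=1..K. 1 / sqrt (real k)) \<le> M * D * (2 * sqrt (real K))"
    using M_pos D_pos by (intro mult_left_mono sum_inverse_sqrt_le) auto
  also have "(\<Sum>k=1..K. c k * (E (k - 1) - E k)) \<le> c K * (D\<^sup>2 - E K)"
  proof (rule weighted_telescope_le[OF _ _ _ K])
    show "c k \<le> c (Suc k)" for k
      using M_pos D_pos by (auto simp: c_def intro!: divide_right_mono mult_left_mono)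
    show "0 \<le> c 1"
      using M_pos D_pos by (simp add: c_def)
    show "E k \<le> D\<^sup>2" for k
      unfolding E_def sqdist_to_out_def using u v out_in_domain by (intro diameter_bound)
  qed
  also have "c K * (D\<^sup>2 - E K) \<le> c K * D\<^sup>2"
    using M_pos D_pos by (intro mult_left_mono) (auto simp: c_def E_def sqdist_to_out_def)
  also have "c K * D\<^sup>2 = 2 * M * D * sqrt (real K)"
    using D_pos by (simp add: c_def power2_eq_square)
  finally show ?thesis
    by (simp add: mult_ac)
qed

lemma running_avg_eps_saddle_point:
  assumes K: "1 \<le> K" and large: "8 * (M * D / \<epsilon>) \<le> sqrt (real K)"
  shows "eps_saddle_point P \<epsilon> (running_avg (hatx T) K) (running_avg (haty T) K)"
proof -
  let ?x = "running_avg (hatx T) K" and ?y = "running_avg (haty T) K"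
  have convx: "mix_convex_on (domx P) (\<lambda>u. f u v + h1 u)" if "v \<in> domy P" for v
    unfolding f_def h1_def using that coupling_finite
    by (intro mix_convex_on_add finite_mix_convex_on[OF regx coupling_convex]
        proper_mix_convex_on[OF regx]) auto
  have "mix_convex_on (domy P) (\<lambda>v. real_of_ereal (- coupling P u v) + h2 v)" if "u \<in> domx P" for u
    unfolding h2_def using that coupling_finite
    by (intro mix_convex_on_add finite_mix_convex_on[OF regy coupling_concave]
        proper_mix_convex_on[OF regy]) auto
  then have convy: "mix_convex_on (domy P) (\<lambda>v. - f u v + h2 v)" if "u \<in> domx P" for u
    using that by (simp add: f_def)
  note avgx = mix_convex_on_running_avg[OF convx, of _ "hatx T" K]
    and avgy = mix_convex_on_running_avg[OF convy, of _ "haty T" K]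
  have x: "?x \<in> domx P" and y: "?y \<in> domy P"
    using avgx[OF y0] avgy[OF x0] call_results(1,2) K by blast+
  have "phi P ?x v - phi P u ?y \<le> ereal \<epsilon>" if u: "u \<in> domx P" and v: "v \<in> domy P" for u v
  proof -
    let ?A = "\<Sum>k=1..K. f (hatx T k) v + h1 (hatx T k)"
    let ?B = "\<Sum>k=1..K. - f u (haty T k) + h2 (haty T k)"
    have "f ?x v + h1 ?x \<le> ?A / real K" "- f u ?y + h2 ?y \<le> ?B / real K"
      using avgx[OF v] avgy[OF u] call_results(1,2) K by blast+
    then have "real K * (f ?x v + h1 ?x) \<le> ?A" "real K * (- f u ?y + h2 ?y) \<le> ?B"
      using K by (simp_all add: field_simps)
    moreover have "?A + ?B - real K * (h1 u + h2 v) \<le> real K * (\<epsilon> / 2) + 4 * M * D * sqrt (real K)"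
      using sum_outer_steps[OF K u v] by (simp add: sum.distrib sum_subtractf)
    moreover have "4 * M * D * sqrt (real K) \<le> real K * (\<epsilon> / 2)"
    proof -
      have "8 * M * D \<le> \<epsilon> * sqrt (real K)"
        using large eps by (simp add: field_simps)
      then have "8 * M * D * sqrt (real K) \<le> \<epsilon> * sqrt (real K) * sqrt (real K)"
        by (intro mult_right_mono) auto
      then show ?thesis
        by (simp add: mult_ac)
    qed
    ultimately have "real K * (f ?x v + h1 ?x - f u ?y + h2 ?y - h1 u - h2 v) \<le> real K * \<epsilon>"
      by (simp add: algebra_simps)
    then have "f ?x v + h1 ?x - f u ?y + h2 ?y - h1 u - h2 v \<le> \<epsilon>"
      using K by simp
    then show ?thesis
      using x y u v by (simp add: phi_def coupling_real regx_real regy_real)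
  qed
  then show ?thesis
    using x y by (simp add: eps_saddle_point_def)
qed

lemma call_bound_le: "1 \<le> k \<Longrightarrow> real (call_bound k) \<le> 12 * (M * D / \<epsilon>) * (1 / sqrt (real k)) + 3"
proof -
  assume k: "1 \<le> k"
  have "12 * lam k * M\<^sup>2 / (\<epsilon> / 4) = 12 * (M * D / \<epsilon>) * (1 / sqrt (real k))"
    using M_pos by (simp add: lam_formula[OF k] power2_eq_square mult_ac)
  moreover have "0 \<le> 12 * lam k * M\<^sup>2 / (\<epsilon> / 4)"
    using lam_pos[OF k] eps by simp
  ultimately show ?thesis
    by linarith
qed

text \<open>
  With \<open>r = M * D / \<epsilon>\<close> and \<open>sqrt K \<le> 8 * r + 2\<close>, the total is at most
  \<open>48 * r * (8 * r + 2) + 6 * (64 * r\<^sup>2 + 2) = 768 * r\<^sup>2 + 96 * r + 12\<close>; the linear term is absorbed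
  by \<open>2 * r \<le> r\<^sup>2 + 1\<close>, which makes the leading coefficient \<open>768 + 48 = 816\<close>.
\<close>

lemma total_iterations_le:
  "ereal_of_enat (pbspp_total_iters P lam \<epsilon> T) \<le> ereal (816 * ((M * D / \<epsilon>)\<^sup>2 + 1))"
proof -
  define r where "r = M * D / \<epsilon>"
  have r: "0 < r"
    using M_pos D_pos eps by (simp add: r_def)
  \<comment> \<open>Chosen such that \<open>8 * r \<le> sqrt K\<close>, as \<open>running_avg_eps_saddle_point\<close> requires.\<close>
  define K where "K = nat \<lceil>64 * r\<^sup>2\<rceil> + 1"
  have K: "1 \<le> K" "64 * r\<^sup>2 \<le> real K" "real K \<le> 64 * r\<^sup>2 + 2"
    unfolding K_def using zero_le_power2[of r] by linarith+
  have "8 * r \<le> sqrt (real K)"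
    using K(2) by (intro real_le_rsqrt) (simp add: power_mult_distrib)
  then have "eps_saddle_point P \<epsilon> (running_avg (hatx T) K) (running_avg (haty T) K)"
    using running_avg_eps_saddle_point[OF K(1)] by (simp add: r_def)
  then have "pbspp_total_iters P lam \<epsilon> T \<le> (\<Sum>k=1..K. itersx P lam \<epsilon> T k + itersy P lam \<epsilon> T k)"
    unfolding pbspp_total_iters_def using K(1) by (intro INF_lower) simp
  also have "\<dots> \<le> (\<Sum>k=1..K. enat (2 * call_bound k))"
    by (intro sum_mono iterations_le) simp
  also have "\<dots> = enat (\<Sum>k=1..K. 2 * call_bound k)"
    by (rule enat_sum)
  finally have "ereal_of_enat (pbspp_total_iters P lam \<epsilon> T)
      \<le> ereal_of_enat (enat (\<Sum>k=1..K. 2 * call_bound k))"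
    by (simp only: ereal_of_enat_le_iff)
  also have "\<dots> = ereal (\<Sum>k=1..K. 2 * real (call_bound k))"
    by simp
  also have "(\<Sum>k=1..K. 2 * real (call_bound k)) \<le> (\<Sum>k=1..K. 24 * r * (1 / sqrt (real k)) + 6)"
  proof (rule sum_mono)
    fix k assume "k \<in> {1..K}"
    then show "2 * real (call_bound k) \<le> 24 * r * (1 / sqrt (real k)) + 6"
      using call_bound_le[of k] by (simp add: r_def)
  qed
  also have "\<dots> = 24 * r * (\<Sum>k=1..K. 1 / sqrt (real k)) + 6 * real K"
    by (simp add: sum.distrib sum_distrib_left)
  also have "\<dots> \<le> 24 * r * (2 * sqrt (real K)) + 6 * real K"
    using r by (intro add_right_mono mult_left_mono sum_inverse_sqrt_le) auto
  also have "\<dots> \<le> 24 * r * (2 * (8 * r + 2)) + 6 * (64 * r\<^sup>2 + 2)"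
  proof (intro add_mono mult_left_mono)
    have "64 * r\<^sup>2 + 2 \<le> (8 * r + 2)\<^sup>2"
      using r by (simp add: power2_sum power_mult_distrib)
    then show "sqrt (real K) \<le> 8 * r + 2"
      using K(3) r by (intro real_le_lsqrt) auto
  qed (use r K in auto)
  also have "\<dots> \<le> 816 * (r\<^sup>2 + 1)"
  proof -
    have "0 \<le> (r - 1)\<^sup>2"
      by simp
    then show ?thesis
      by (simp add: power2_eq_square algebra_simps)
  qed
  finally show ?thesis
    by (simp add: r_def)
qed

end

theorem theorem4p2:
  shows "\<exists>C::real. 0 < C \<and>
    (\<forall>(P::spp) (M::real) (D::real) (x0::rvec) (y0::rvec) (\<epsilon>::real) (lam::nat \<Rightarrow> real) (T::spp_trace).
       spp_assumptions P M D \<and> x0 \<in> domx P \<and> y0 \<in> domy P \<and> 0 < \<epsilon> \<and>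
       lam 1 = D / (4 * M) \<and> (\<forall>k\<ge>1. lam k = lam 1 / sqrt (real k)) \<and>
       pbspp_run P M lam x0 y0 \<epsilon> T
       \<longrightarrow> ereal_of_enat (pbspp_total_iters P lam \<epsilon> T) \<le> ereal (C * ((M * D / \<epsilon>)\<^sup>2 + 1)))"
proof (intro exI[of _ 816] conjI allI impI)
  fix P M D x0 y0 \<epsilon> lam T
  assume "spp_assumptions P M D \<and> x0 \<in> domx P \<and> y0 \<in> domy P \<and> 0 < \<epsilon> \<and>
       lam 1 = D / (4 * M) \<and> (\<forall>k\<ge>1. lam k = lam 1 / sqrt (real k)) \<and>
       pbspp_run P M lam x0 y0 \<epsilon> T"
  then interpret pbspp_execution P M D x0 y0 \<epsilon> lam T
    by unfold_locales blast+
  show "ereal_of_enat (pbspp_total_iters P lam \<epsilon> T) \<le> ereal (816 * ((M * D / \<epsilon>)\<^sup>2 + 1))"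
    by (rule total_iterations_le)
qed simp

end
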